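(* Let $G$ be a finite connected graph with vertices $v_1,\dots,v_n$ and $m$ edges, carrying data $H_{uu}$, $h$, $\gamma$ defining the Hermitian matrix $\mathbf{H}$ as in the context. Let $\Gamma$ be a finite group with $|\Gamma|=p$, let $\alpha:D(G)\to\Gamma$ be an ordinary voltage assignment, and let $\rho_1=1,\rho_2,\dots,\rho_k$ be the inequivalent irreducible representations of $\Gamma$, with $f_i=\deg\rho_i$ ($f_1=1$). Let $\lambda\in\mathbb{C}$ with $H_{uu}-\lambda-i\Gamma_u\neq0$ for all $u\in V(G)$. If the $\Gamma$-covering $G^\alpha$ is connected, then the bond scattering matrix $\tilde{\mathbf{U}}(\lambda)$ of $G^\alpha$ (with respect to the induced Hermitian matrix $\tilde{\mathbf{H}}$) satisfies \[ \det(\mathbf{I}_{2mp}-\tilde{\mathbf{U}}(\lambda))=\det(\mathbf{I}_{2m}-\mathbf{U}(\lambda))\prod_{i=2}^{k}\det\Bigl(\mathbf{I}_{2mf_i}-\sum_{h\in\Gamma}\rho_i(h)\otimes\mathbf{U}_h\Bigr)^{f_i} \] \[ =\frac{2^{mp}(-1)^{np}\det(\lambda\mathbf{I}_n-\mathbf{H})}{\prod_{u\in V(G)}(H_{uu}-\lambda-i\Gamma_u)^p}\prod_{i=2}^{k}\det\Bigl(\lambda\mathbf{I}_{nf_i}-\sum_{h\in\Gamma}\rho_i(h)\otimes\mathbf{H}_h-\mathbf{I}_{f_i}\otimes\mathrm{diag}(\mathbf{H})\Bigr)^{f_i}, \] where $\mathrm{diag}(\mathbf{H})$ is the diagonal matrix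 with entries $H_{v_1v_1},\dots,H_{v_nv_n}$.
   Context: $G$ is a finite connected graph without loops or multiple edges; $D(G)$ is its set of arcs ($2m$ of them); for $e=(u,v)$, $o(e)=u$, $t(e)=v$, $e^{-1}=(v,u)$. Data: real numbers $H_{uu}$ ($u\in V(G)$), $h:D(G)\to[0,\infty)$, $\gamma:D(G)\to[-\pi/2,\pi/2]$ with $h_{f^{-1}}=h_f$, $\gamma_{f^{-1}}=-\gamma_f$; write $h_{uv}=h_{(u,v)}$, $\gamma_{uv}=\gamma_{(u,v)}$. The Hermitian matrix $\mathbf{H}=(H_{uv})$ has diagonal $H_{uu}$ and, for $u\ne v$, $H_{uv}=h_{uv}e^{2i\gamma_{uv}}$ if $(u,v)\in D(G)$, else $0$. $\Gamma_u=\sum_{o(f)=u}h_f$. For a graph with such data, $\sigma^{(u)}_{ef}(\lambda)=i\delta_{e^{-1},f}-2\frac{\sqrt{h_e}\sqrt{h_f}}{H_{uu}-\lambda-i\Gamma_u}e^{i(\gamma_f+\gamma_e)}$, and the bond scattering matrix $\mathbf{U}(\lambda)=(U_{ef})_{e,f\in D(G)}$ has $U_{ef}=\sigma^{(t(e))}_{ef}(\lambda)$ if $t(e)=o(f)$, $0$ otherwise. An ordinary voltage assignment is a map $\alpha:D(G)\to\Gamma$ with $\alpha(v,u)=\alpha(u,v)^{-1}$. The derived graph ($\Gamma$-covering) $G^\alpha$ has vertex set $V(G)\times\Gamma$ and an arc $((u,g),(v,g\alpha(u,v)))$ for each $(u,v)\in D(G)$, $g\in\Gamma$. It carries the induced data: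 $\tilde H_{(u,g)(u,g)}=H_{uu}$, $\tilde h((u,g),(v,g\alpha(u,v)))=h_{uv}$, $\tilde\gamma((u,g),(v,g\alpha(u,v)))=\gamma_{uv}$, giving the Hermitian matrix $\tilde{\mathbf{H}}=\mathbf{H}(G^\alpha)$ and bond scattering matrix $\tilde{\mathbf{U}}(\lambda)$ of $G^\alpha$ defined in the same way. For $h\in\Gamma$: $\mathbf{H}_h=(H^{(h)}_{uv})$ is the $n\times n$ matrix with $H^{(h)}_{uv}=h_{uv}e^{2i\gamma_{uv}}$ if $(u,v)\in D(G)$ and $\alpha(u,v)=h$, else $0$; $\mathbf{U}_h$ is the $2m\times2m$ matrix with $(e,f)$-entry $\sigma^{(t(e))}_{ef}(\lambda)$ if $t(e)=o(f)$ and $\alpha(e)=h$, else $0$. $\mathbf{A}\otimes\mathbf{B}$ denotes the Kronecker product (each entry $a_{ij}$ of $\mathbf{A}$ replaced by $a_{ij}\mathbf{B}$). *)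

theory Defs
  imports
    "Graph_Theory.Graph_Theory"
    "Jordan_Normal_Form.DL_Rank"
    "HOL-Algebra.Coset"
    Complex_Main
begin

text \<open>
  Simple graphs are the symmetric, loop-free, finite digraphs with pairs as arcs
  (\<^locale>\<open>pair_graph\<close>); an arc \<open>e = (u,v)\<close> has origin \<open>fst e\<close>, terminus \<open>snd e\<close> and
  inverse \<open>prod.swap e\<close>. A matrix indexed by a finite set is read off along a list that
  enumerates the set without repetition.
\<close>

definition index_mat :: "'i list \<Rightarrow> ('i \<Rightarrow> 'i \<Rightarrow> complex) \<Rightarrow> complex mat" where
  "index_mat xs F = mat (length xs) (length xs) (\<lambda>(i, j). F (xs ! i) (xs ! j))"

definition enumerates :: "'i list \<Rightarrow> 'i set \<Rightarrow> bool" where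
  "enumerates xs S \<longleftrightarrow> distinct xs \<and> set xs = S"

definition kronecker :: "complex mat \<Rightarrow> complex mat \<Rightarrow> complex mat" (infixl "\<otimes>\<^sub>K" 70) where
  "A \<otimes>\<^sub>K B = mat (dim_row A * dim_row B) (dim_col A * dim_col B)
     (\<lambda>(i, j). A $$ (i div dim_row B, j div dim_col B) * B $$ (i mod dim_row B, j mod dim_col B))"


subsection \<open>Hermitian matrix and bond scattering matrix\<close>

definition arc_data :: "'a pair_pre_digraph \<Rightarrow> ('a \<times> 'a \<Rightarrow> real) \<Rightarrow> ('a \<times> 'a \<Rightarrow> real) \<Rightarrow> bool" where
  "arc_data G h \<gamma> \<longleftrightarrow> (\<forall>e \<in> parcs G.
     0 \<le> h e \<and> h (prod.swap e) = h e \<and>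
     - (pi / 2) \<le> \<gamma> e \<and> \<gamma> e \<le> pi / 2 \<and> \<gamma> (prod.swap e) = - \<gamma> e)"

definition hermitian_mat ::
  "'a pair_pre_digraph \<Rightarrow> ('a \<Rightarrow> real) \<Rightarrow> ('a \<times> 'a \<Rightarrow> real) \<Rightarrow> ('a \<times> 'a \<Rightarrow> real) \<Rightarrow> 'a list \<Rightarrow> complex mat"
where
  "hermitian_mat G H h \<gamma> vs = index_mat vs (\<lambda>u v.
     if u = v then of_real (H u)
     else if (u, v) \<in> parcs G then of_real (h (u, v)) * exp (2 * \<i> * of_real (\<gamma> (u, v)))
     else 0)"

definition out_weight :: "'a pair_pre_digraph \<Rightarrow> ('a \<times> 'a \<Rightarrow> real) \<Rightarrow> 'a \<Rightarrow> real" where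
  "out_weight G h u = (\<Sum>f \<in> {f \<in> parcs G. fst f = u}. h f)"

definition resolvent_denom ::
  "'a pair_pre_digraph \<Rightarrow> ('a \<Rightarrow> real) \<Rightarrow> ('a \<times> 'a \<Rightarrow> real) \<Rightarrow> complex \<Rightarrow> 'a \<Rightarrow> complex"
where
  "resolvent_denom G H h \<mu> u = of_real (H u) - \<mu> - \<i> * of_real (out_weight G h u)"

definition scattering ::
  "'a pair_pre_digraph \<Rightarrow> ('a \<Rightarrow> real) \<Rightarrow> ('a \<times> 'a \<Rightarrow> real) \<Rightarrow> ('a \<times> 'a \<Rightarrow> real) \<Rightarrow> complex
    \<Rightarrow> 'a \<Rightarrow> 'a \<times> 'a \<Rightarrow> 'a \<times> 'a \<Rightarrow> complex"
where
  "scattering G H h \<gamma> \<mu> u e f =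
     \<i> * (if prod.swap e = f then 1 else 0)
     - 2 * (of_real (sqrt (h e)) * of_real (sqrt (h f)) / resolvent_denom G H h \<mu> u)
         * exp (\<i> * of_real (\<gamma> f + \<gamma> e))"

definition bond_scattering_mat ::
  "'a pair_pre_digraph \<Rightarrow> ('a \<Rightarrow> real) \<Rightarrow> ('a \<times> 'a \<Rightarrow> real) \<Rightarrow> ('a \<times> 'a \<Rightarrow> real) \<Rightarrow> complex
    \<Rightarrow> ('a \<times> 'a) list \<Rightarrow> complex mat"
where
  "bond_scattering_mat G H h \<gamma> \<mu> es = index_mat es (\<lambda>e f.
     if snd e = fst f then scattering G H h \<gamma> \<mu> (snd e) e f else 0)"


subsection \<open>Voltage assignments and derived graphs\<close>

definition voltage_assignment ::
  "'a pair_pre_digraph \<Rightarrow> ('g, 'b) monoid_scheme \<Rightarrow> ('a \<times> 'a \<Rightarrow> 'g) \<Rightarrow> bool"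
where
  "voltage_assignment G \<Gamma> \<alpha> \<longleftrightarrow>
     (\<forall>e \<in> parcs G. \<alpha> e \<in> carrier \<Gamma> \<and> \<alpha> (prod.swap e) = inv\<^bsub>\<Gamma>\<^esub> (\<alpha> e))"

definition derived_graph ::
  "'a pair_pre_digraph \<Rightarrow> ('g, 'b) monoid_scheme \<Rightarrow> ('a \<times> 'a \<Rightarrow> 'g) \<Rightarrow> ('a \<times> 'g) pair_pre_digraph"
where
  "derived_graph G \<Gamma> \<alpha> =
     \<lparr> pverts = pverts G \<times> carrier \<Gamma>,
       parcs = {((u, g), (v, g \<otimes>\<^bsub>\<Gamma>\<^esub> \<alpha> (u, v))) | u v g. (u, v) \<in> parcs G \<and> g \<in> carrier \<Gamma>} \<rparr>"

definition lift_vertex_data :: "('a \<Rightarrow> real) \<Rightarrow> 'a \<times> 'g \<Rightarrow> real" where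
  "lift_vertex_data H = (\<lambda>(u, g). H u)"

definition lift_arc_data :: "('a \<times> 'a \<Rightarrow> real) \<Rightarrow> ('a \<times> 'g) \<times> ('a \<times> 'g) \<Rightarrow> real" where
  "lift_arc_data h = (\<lambda>((u, g), (v, g')). h (u, v))"

definition hermitian_part_mat ::
  "'a pair_pre_digraph \<Rightarrow> ('a \<times> 'a \<Rightarrow> real) \<Rightarrow> ('a \<times> 'a \<Rightarrow> real) \<Rightarrow> ('a \<times> 'a \<Rightarrow> 'g) \<Rightarrow> 'g
    \<Rightarrow> 'a list \<Rightarrow> complex mat"
where
  "hermitian_part_mat G h \<gamma> \<alpha> g vs = index_mat vs (\<lambda>u v.
     if (u, v) \<in> parcs G \<and> \<alpha> (u, v) = g
     then of_real (h (u, v)) * exp (2 * \<i> * of_real (\<gamma> (u, v))) else 0)"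

definition bond_scattering_part_mat ::
  "'a pair_pre_digraph \<Rightarrow> ('a \<Rightarrow> real) \<Rightarrow> ('a \<times> 'a \<Rightarrow> real) \<Rightarrow> ('a \<times> 'a \<Rightarrow> real) \<Rightarrow> complex
    \<Rightarrow> ('a \<times> 'a \<Rightarrow> 'g) \<Rightarrow> 'g \<Rightarrow> ('a \<times> 'a) list \<Rightarrow> complex mat"
where
  "bond_scattering_part_mat G H h \<gamma> \<mu> \<alpha> g es = index_mat es (\<lambda>e f.
     if snd e = fst f \<and> \<alpha> e = g then scattering G H h \<gamma> \<mu> (snd e) e f else 0)"


subsection \<open>Complex matrix representations of a group\<close>

text \<open>\<open>units_of (ring_mat TYPE(complex) d ())\<close> is the general linear group of degree \<open>d\<close> over the complex numbers.\<close>

definition group_representation :: "('g, 'b) monoid_scheme \<Rightarrow> nat \<Rightarrow> ('g \<Rightarrow> complex mat) \<Rightarrow> bool" where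
  "group_representation \<Gamma> d \<rho> \<longleftrightarrow> \<rho> \<in> hom \<Gamma> (units_of (ring_mat TYPE(complex) d ()))"

definition irreducible_representation ::
  "('g, 'b) monoid_scheme \<Rightarrow> nat \<Rightarrow> ('g \<Rightarrow> complex mat) \<Rightarrow> bool"
where
  "irreducible_representation \<Gamma> d \<rho> \<longleftrightarrow>
     group_representation \<Gamma> d \<rho> \<and> 0 < d \<and>
     (\<forall>W. subspace class_ring W (module_vec TYPE(complex) d) \<and>
          (\<forall>g \<in> carrier \<Gamma>. \<forall>w \<in> W. \<rho> g *\<^sub>v w \<in> W)
        \<longrightarrow> W = {0\<^sub>v d} \<or> W = carrier_vec d)"

definition equivalent_representations ::
  "('g, 'b) monoid_scheme \<Rightarrow> nat \<Rightarrow> ('g \<Rightarrow> complex mat) \<Rightarrow> nat \<Rightarrow> ('g \<Rightarrow> complex mat) \<Rightarrow> bool"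
where
  "equivalent_representations \<Gamma> d \<rho> d' \<rho>' \<longleftrightarrow>
     d = d' \<and> (\<exists>P \<in> Units (ring_mat TYPE(complex) d ()).
       \<forall>g \<in> carrier \<Gamma>. P * \<rho> g = \<rho>' g * P)"

definition all_irreducible_representations ::
  "('g, 'b) monoid_scheme \<Rightarrow> nat \<Rightarrow> (nat \<Rightarrow> nat) \<Rightarrow> (nat \<Rightarrow> 'g \<Rightarrow> complex mat) \<Rightarrow> bool"
where
  "all_irreducible_representations \<Gamma> k f \<rho> \<longleftrightarrow>
     (\<forall>i \<in> {1..k}. irreducible_representation \<Gamma> (f i) (\<rho> i)) \<and>
     (\<forall>i \<in> {1..k}. \<forall>j \<in> {1..k}. i \<noteq> j \<longrightarrow>
        \<not> equivalent_representations \<Gamma> (f i) (\<rho> i) (f j) (\<rho> j)) \<and>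
     (\<forall>d \<sigma>. irreducible_representation \<Gamma> d \<sigma> \<longrightarrow>
        (\<exists>i \<in> {1..k}. equivalent_representations \<Gamma> d \<sigma> (f i) (\<rho> i)))"

end

theory Submission
  imports Defs "Jordan_Normal_Form.Spectral_Radius"
begin

text \<open>
  Let \<open>\<rho>\<close> be a representation of degree \<open>d\<close>. The twisted bond scattering matrix
  \<open>\<Sum>\<^sub>g \<rho>(g) \<otimes> U\<^sub>g\<close> equals \<open>i J - 2 A D\<^sup>-\<^sup>1 B\<close>, where \<open>J\<close> is the twisted arc reversal, an involution,
  \<open>D\<close> is the diagonal of the resolvent denominators, and \<open>A\<close>, \<open>B\<close> pass between arcs and vertices.
  Since \<open>(1 - i J)(1 + i J) = 2\<close> and \<open>det (1 - i J) = 2\<^bsup>md\<^esup>\<close>, the identity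
  \<open>det (1 + X Y) = det (1 + Y X)\<close> turns the determinant over arcs into one over vertices, of the
  matrix \<open>D + B A + i B J A\<close>, and this is the twisted Hermitian matrix minus the spectral parameter.

  The covering corresponds to the regular representation. By Schur's orthogonality relations the
  matrix coefficients of the irreducible representations are linearly independent, and they span
  all functions on the group; in this basis the regular representation is block diagonal, with
  \<open>f\<^sub>i\<close> copies of \<open>\<rho>\<^sub>i\<close>.
\<close>

section \<open>Determinants over finite index sets\<close>

text \<open>The determinants compared live over index sets of different kinds: group elements
  against matrix coefficients, arcs against vertices. Determinants are therefore freed of
  enumerations, and changes of basis rest on \<open>det (1 + X * Y) = det (1 + Y * X)\<close> with
  rectangular factors, so that no sizes need to be compared beforehand. That the squares of the
  degrees add up to the group order comes out afterwards, from a comparison of traces. It collects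
  the constants \<open>2 ^ (m * f i)\<close> and \<open>(-1) ^ (n * f i)\<close>, each raised to the
  power \<open>f i\<close>, into \<open>2 ^ (m * p)\<close> and \<open>(-1) ^ (n * p)\<close>. The
  second equality is proved one representation at a time, so the Hermitian matrix of the covering is
  never decomposed. The scattering weights are products of amplitudes sqrt(h_e) exp(i \<gamma>_e).
  An amplitude times that of the reversed arc is h_e; summed over the arcs leaving u this is the
  out-weight, which cancels the term -i \<Gamma>_u of the denominator. The square of an amplitude is
  the off-diagonal entry of the Hermitian matrix. Completeness of the matrix coefficients is reached
  by minimality and positivity instead of complete reducibility.\<close>

lemma det_one_add_mult_commute:
  fixes A B :: "complex mat"
  assumes A: "A \<in> carrier_mat n m" and B: "B \<in> carrier_mat m n"
  shows "det (1\<^sub>m n + A * B) = det (1\<^sub>m m + B * A)"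
proof -
  \<comment> \<open>The unitriangular \<open>?T\<close> clears the block \<open>- A\<close> of
    \<open>?M\<close> from either side: on the right it leaves the diagonal block
    \<open>B * A + 1\<close>, on the left \<open>1 + A * B\<close>.\<close>
  let ?M = "four_block_mat (1\<^sub>m n) (- A) B (1\<^sub>m m)"
  let ?T = "four_block_mat (1\<^sub>m n) A (0\<^sub>m m n) (1\<^sub>m m)"
  have M: "?M \<in> carrier_mat (n + m) (n + m)" and T: "?T \<in> carrier_mat (n + m) (n + m)"
    using A B by auto
  have dT: "det ?T = 1"
    by (subst det_four_block_mat_lower_left_zero[of _ n _ m]) (use A in auto)
  have "?M * ?T = four_block_mat (1\<^sub>m n) (0\<^sub>m n m) B (B * A + 1\<^sub>m m)"
    by (subst mult_four_block_mat[of _ n n _ m _ m]) (use A B in \<open>auto intro!: cong_four_block_mat\<close>)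
  then have "det (?M * ?T) = det (1\<^sub>m m + B * A)"
    using A B by (simp, subst det_four_block_mat_upper_right_zero[of _ n _ m]) (auto simp: comm_add_mat[of _ m m])
  moreover have "?T * ?M = four_block_mat (1\<^sub>m n + A * B) (0\<^sub>m n m) B (1\<^sub>m m)"
    by (subst mult_four_block_mat[of _ n n _ m _ m]) (use A B in \<open>auto intro!: cong_four_block_mat\<close>)
  then have "det (?T * ?M) = det (1\<^sub>m n + A * B)"
    using A B by (simp, subst det_four_block_mat_upper_right_zero[of _ n _ m]) auto
  ultimately show ?thesis
    using det_mult[OF M T] det_mult[OF T M] dT by simp
qed

text \<open>For finite \<open>S\<close> the chosen enumeration is immaterial by
  \<open>det_index_mat\<close>. Products, images and disjoint unions can then serve as index sets
  without being ordered.\<close>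

definition idet :: "'i set \<Rightarrow> ('i \<Rightarrow> 'i \<Rightarrow> complex) \<Rightarrow> complex" where
  "idet S F = det (index_mat (SOME xs. enumerates xs S) F)"

definition kdelta :: "'i \<Rightarrow> 'i \<Rightarrow> complex" where
  "kdelta x y = (if x = y then 1 else 0)"

lemma kdelta_refl [simp]: "kdelta x x = 1"
  by (simp add: kdelta_def)

lemma sum_kdelta [simp]:
  assumes "finite S"
  shows "(\<Sum>y\<in>S. kdelta x y * F y) = (if x \<in> S then F x else 0)"
    and "(\<Sum>y\<in>S. F y * kdelta x y) = (if x \<in> S then F x else 0)"
    and "(\<Sum>y\<in>S. kdelta y x * F y) = (if x \<in> S then F x else 0)"
    and "(\<Sum>y\<in>S. F y * kdelta y x) = (if x \<in> S then F x else 0)"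
  using assms by (simp_all add: kdelta_def if_distrib if_distribR sum.delta sum.delta' cong: if_cong)

definition rect_mat :: "'i list \<Rightarrow> 'j list \<Rightarrow> ('i \<Rightarrow> 'j \<Rightarrow> complex) \<Rightarrow> complex mat" where
  "rect_mat xs ys F = mat (length xs) (length ys) (\<lambda>(i, j). F (xs ! i) (ys ! j))"

lemma rect_mat_carrier [simp]: "rect_mat xs ys F \<in> carrier_mat (length xs) (length ys)"
  by (simp add: rect_mat_def)

lemma index_mat_carrier [simp]: "index_mat xs F \<in> carrier_mat (length xs) (length xs)"
  by (simp add: index_mat_def)

lemma index_mat_eq_rect_mat: "index_mat xs F = rect_mat xs xs F"
  by (simp add: rect_mat_def index_mat_def)

lemma sum_enumerates:
  assumes "enumerates xs S"
  shows "(\<Sum>i = 0..<length xs. F (xs ! i)) = sum F S"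
proof -
  have "inj_on ((!) xs) {0..<length xs}" "(!) xs ` {0..<length xs} = S"
    using assms by (auto simp: enumerates_def inj_on_nth in_set_conv_nth)
  then show ?thesis
    by (metis (no_types, lifting) comp_apply sum.cong sum.reindex)
qed

lemma rect_mat_mult:
  assumes "enumerates ys T"
  shows "rect_mat xs ys F * rect_mat ys zs K = rect_mat xs zs (\<lambda>x z. \<Sum>y\<in>T. F x y * K y z)"
  by (rule eq_matI)
    (auto simp: rect_mat_def scalar_prod_def sum_enumerates[OF assms, symmetric])

lemma rect_mat_cong:
  assumes "\<And>x y. x \<in> set xs \<Longrightarrow> y \<in> set ys \<Longrightarrow> F x y = K x y"
  shows "rect_mat xs ys F = rect_mat xs ys K"
  by (rule eq_matI) (auto simp: rect_mat_def assms)

lemma index_mat_kdelta: "distinct xs \<Longrightarrow> index_mat xs kdelta = 1\<^sub>m (length xs)"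
  by (rule eq_matI) (auto simp: index_mat_def kdelta_def nth_eq_iff_index_eq)

lemma index_mat_add: "index_mat xs F + index_mat xs K = index_mat xs (\<lambda>x y. F x y + K x y)"
  by (rule eq_matI) (auto simp: index_mat_def)

lemma enumerates_exists: "finite S \<Longrightarrow> \<exists>xs. enumerates xs S"
  using finite_distinct_list[of S] by (auto simp: enumerates_def)

lemma det_index_mat_one_add_mult_commute:
  assumes xs: "enumerates xs S" and ys: "enumerates ys T"
  shows "det (index_mat xs (\<lambda>x x'. kdelta x x' + (\<Sum>y\<in>T. A x y * B y x'))) =
         det (index_mat ys (\<lambda>y y'. kdelta y y' + (\<Sum>x\<in>S. B y x * A x y')))"
proof -
  have "index_mat xs (\<lambda>x x'. kdelta x x' + (\<Sum>y\<in>T. A x y * B y x')) =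
        1\<^sub>m (length xs) + rect_mat xs ys A * rect_mat ys xs B"
    using xs by (simp add: rect_mat_mult[OF ys] index_mat_kdelta[symmetric] enumerates_def index_mat_add
        flip: index_mat_eq_rect_mat)
  moreover have "index_mat ys (\<lambda>y y'. kdelta y y' + (\<Sum>x\<in>S. B y x * A x y')) =
        1\<^sub>m (length ys) + rect_mat ys xs B * rect_mat xs ys A"
    using ys by (simp add: rect_mat_mult[OF xs] index_mat_kdelta[symmetric] enumerates_def index_mat_add
        flip: index_mat_eq_rect_mat)
  ultimately show ?thesis
    by (simp add: det_one_add_mult_commute[of _ "length xs" "length ys"])
qed

text \<open>Writing \<open>F\<close> as 1 + (F - 1) 1 along one enumeration and as 1 + 1 (F - 1)
  along the other, with \<open>kdelta\<close> as the rectangular matrix between them, makes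
  independence of the order an instance of the commutation rule; permutations and their signs do not
  enter.\<close>

lemma det_index_mat:
  assumes xs: "enumerates xs S"
  shows "det (index_mat xs F) = idet S F"
proof -
  define ys where "ys = (SOME ys. enumerates ys S)"
  have ys: "enumerates ys S"
    unfolding ys_def using xs by (rule someI)
  have fin: "finite S" using xs by (auto simp: enumerates_def)
  have 1: "index_mat zs F =
      index_mat zs (\<lambda>x x'. kdelta x x' + (\<Sum>y\<in>S. (F x y - kdelta x y) * kdelta y x'))"
    "index_mat zs F =
      index_mat zs (\<lambda>x x'. kdelta x x' + (\<Sum>y\<in>S. kdelta x y * (F y x' - kdelta y x')))"
    if "enumerates zs S" for zs
    unfolding index_mat_eq_rect_mat using that fin
    by (auto intro!: rect_mat_cong simp: enumerates_def)
  show ?thesis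
    unfolding idet_def ys_def[symmetric] 1(1)[OF xs] 1(2)[OF ys]
    by (rule det_index_mat_one_add_mult_commute[OF xs ys])
qed

lemma idet_cong:
  assumes "finite S" "\<And>x y. x \<in> S \<Longrightarrow> y \<in> S \<Longrightarrow> F x y = K x y"
  shows "idet S F = idet S K"
proof -
  obtain xs where xs: "enumerates xs S" using enumerates_exists assms(1) by auto
  have "index_mat xs F = index_mat xs K"
    unfolding index_mat_eq_rect_mat using xs assms(2) by (auto intro!: rect_mat_cong simp: enumerates_def)
  then show ?thesis by (simp flip: det_index_mat[OF xs])
qed

lemma idet_mult:
  assumes "finite S"
  shows "idet S (\<lambda>x z. \<Sum>y\<in>S. F x y * K y z) = idet S F * idet S K"
proof -
  obtain xs where xs: "enumerates xs S" using enumerates_exists assms(1) by auto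
  show ?thesis
    unfolding det_index_mat[OF xs, symmetric] index_mat_eq_rect_mat rect_mat_mult[OF xs, symmetric]
    by (rule det_mult[of _ "length xs"]) auto
qed

lemma idet_one_add_mult_commute:
  assumes "finite S" "finite T"
  shows "idet S (\<lambda>x x'. kdelta x x' + (\<Sum>y\<in>T. A x y * B y x')) =
         idet T (\<lambda>y y'. kdelta y y' + (\<Sum>x\<in>S. B y x * A x y'))"
proof -
  obtain xs ys where xs: "enumerates xs S" and ys: "enumerates ys T"
    using enumerates_exists assms by meson
  show ?thesis
    using det_index_mat_one_add_mult_commute[OF xs ys] by (simp add: det_index_mat[OF xs] det_index_mat[OF ys])
qed

text \<open>With C = (A - 1) Q one has A = 1 + C Q' and B = 1 + Q' C. The index sets may have
  different types, and their equal size is not presupposed.\<close>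

lemma idet_similar:
  assumes fin: "finite S" "finite T"
    and QQ': "\<And>x x'. x \<in> S \<Longrightarrow> x' \<in> S \<Longrightarrow> (\<Sum>y\<in>T. Q x y * Q' y x') = kdelta x x'"
    and Q'Q: "\<And>y y'. y \<in> T \<Longrightarrow> y' \<in> T \<Longrightarrow> (\<Sum>x\<in>S. Q' y x * Q x y') = kdelta y y'"
    and AQ: "\<And>x y. x \<in> S \<Longrightarrow> y \<in> T \<Longrightarrow> (\<Sum>x'\<in>S. A x x' * Q x' y) = (\<Sum>y'\<in>T. Q x y' * B y' y)"
  shows "idet S A = idet T B"
proof -
  define C where "C x y = (\<Sum>x'\<in>S. (A x x' - kdelta x x') * Q x' y)" for x y
  have "A x x' = kdelta x x' + (\<Sum>y\<in>T. C x y * Q' y x')" if "x \<in> S" "x' \<in> S" for x x'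
  proof -
    have "(\<Sum>y\<in>T. C x y * Q' y x') = (\<Sum>z\<in>S. (A x z - kdelta x z) * (\<Sum>y\<in>T. Q z y * Q' y x'))"
      unfolding C_def sum_distrib_left sum_distrib_right by (subst sum.swap) (simp add: mult.assoc)
    also have "\<dots> = (\<Sum>z\<in>S. (A x z - kdelta x z) * kdelta z x')"
      using QQ' that by simp
    finally show ?thesis using fin that by simp
  qed
  then have "idet S A = idet S (\<lambda>x x'. kdelta x x' + (\<Sum>y\<in>T. C x y * Q' y x'))"
    using fin by (intro idet_cong) auto
  also have "\<dots> = idet T (\<lambda>y y'. kdelta y y' + (\<Sum>x\<in>S. Q' y x * C x y'))"
    by (rule idet_one_add_mult_commute[OF fin])
  also have "\<dots> = idet T B"
  proof (rule idet_cong[OF fin(2)])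
    fix y y' assume y: "y \<in> T" "y' \<in> T"
    have "C x y' = (\<Sum>z\<in>T. Q x z * (B z y' - kdelta z y'))" if "x \<in> S" for x
      using AQ[OF that y(2)] that fin y
      by (simp add: C_def left_diff_distrib right_diff_distrib sum_subtractf)
    then have "(\<Sum>x\<in>S. Q' y x * C x y') = (\<Sum>x\<in>S. Q' y x * (\<Sum>z\<in>T. Q x z * (B z y' - kdelta z y')))"
      by simp
    also have "\<dots> = (\<Sum>z\<in>T. (\<Sum>x\<in>S. Q' y x * Q x z) * (B z y' - kdelta z y'))"
      unfolding sum_distrib_left sum_distrib_right by (subst sum.swap) (simp add: mult.assoc)
    also have "\<dots> = (\<Sum>z\<in>T. kdelta y z * (B z y' - kdelta z y'))"
      using Q'Q y by simp
    finally show "kdelta y y' + (\<Sum>x\<in>S. Q' y x * C x y') = B y y'"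
      using fin y by simp
  qed
  finally show ?thesis .
qed

lemma idet_reindex:
  assumes "finite S" "bij_betw b S T"
  shows "idet S (\<lambda>x y. F (b x) (b y)) = idet T F"
proof -
  obtain xs where xs: "enumerates xs S" using enumerates_exists assms(1) by auto
  have "enumerates (map b xs) T"
    using xs assms(2) by (auto simp: enumerates_def distinct_map bij_betw_def)
  moreover have "index_mat (map b xs) F = index_mat xs (\<lambda>x y. F (b x) (b y))"
    by (rule eq_matI) (auto simp: index_mat_def)
  ultimately show ?thesis
    using det_index_mat[OF xs] det_index_mat by metis
qed

lemma idet_block_triangular:
  assumes fin: "finite S" "finite T" and disj: "S \<inter> T = {}"
    and zero: "\<And>x y. x \<in> S \<Longrightarrow> y \<in> T \<Longrightarrow> F x y = 0"
  shows "idet (S \<union> T) F = idet S F * idet T F"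
proof -
  obtain xs ys where xs: "enumerates xs S" and ys: "enumerates ys T"
    using enumerates_exists fin by meson
  have e: "enumerates (xs @ ys) (S \<union> T)"
    using xs ys disj by (auto simp: enumerates_def)
  have z: "F (xs ! i) (ys ! j) = 0" if "i < length xs" "j < length ys" for i j
    using that xs ys zero by (auto simp: enumerates_def)
  have "index_mat (xs @ ys) F = four_block_mat (index_mat xs F) (0\<^sub>m (length xs) (length ys))
          (rect_mat ys xs F) (index_mat ys F)"
    by (rule eq_matI) (auto simp: index_mat_def rect_mat_def nth_append z)
  then show ?thesis
    unfolding det_index_mat[OF e, symmetric] det_index_mat[OF xs, symmetric] det_index_mat[OF ys, symmetric]
    by (simp, intro det_four_block_mat_upper_right_zero) auto
qed

lemma idet_empty [simp]: "idet {} F = 1"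
  using det_index_mat[of "[]" "{}" F] by (simp add: enumerates_def index_mat_def)

lemma idet_singleton [simp]: "idet {x} F = F x x"
  using det_index_mat[of "[x]" "{x}" F] by (simp add: enumerates_def index_mat_def det_single)

lemma idet_Sigma_block_diagonal:
  assumes "finite I" "\<And>i. i \<in> I \<Longrightarrow> finite (T i)"
    and zero: "\<And>i j x y. i \<in> I \<Longrightarrow> j \<in> I \<Longrightarrow> i \<noteq> j \<Longrightarrow> x \<in> T i \<Longrightarrow> y \<in> T j \<Longrightarrow> F (i, x) (j, y) = 0"
  shows "idet (Sigma I T) F = (\<Prod>i\<in>I. idet (T i) (\<lambda>x y. F (i, x) (i, y)))"
  using assms
proof (induction I)
  case (insert i I)
  have eq: "Sigma (insert i I) T = Pair i ` T i \<union> Sigma I T" by auto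
  have "idet (Sigma (insert i I) T) F = idet (Pair i ` T i) F * idet (Sigma I T) F"
    unfolding eq using insert by (intro idet_block_triangular) (auto intro!: insert.prems(2))
  moreover have "idet (T i) (\<lambda>x y. F (i, x) (i, y)) = idet (Pair i ` T i) F"
    using insert by (intro idet_reindex) (auto simp: bij_betw_def inj_on_def)
  moreover have "idet (Sigma I T) F = (\<Prod>i\<in>I. idet (T i) (\<lambda>x y. F (i, x) (i, y)))"
    using insert by (intro insert.IH) auto
  ultimately show ?case using insert by simp
qed simp

lemma idet_diagonal:
  assumes "finite S"
  shows "idet S (\<lambda>x y. kdelta x y * d y) = (\<Prod>x\<in>S. d x)"
proof -
  \<comment> \<open>A dummy second coordinate makes every diagonal entry a block of size 1.\<close>
  have "idet S (\<lambda>x y. kdelta x y * d y) = idet (S \<times> {()}) (\<lambda>(x, _) (y, _). kdelta x y * d y)"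
    by (subst idet_reindex[of S "\<lambda>x. (x, ())" "S \<times> {()}", symmetric])
      (use assms in \<open>auto simp: bij_betw_def inj_on_def image_def\<close>)
  also have "\<dots> = (\<Prod>x\<in>S. d x)"
    by (subst idet_Sigma_block_diagonal) (use assms in \<open>auto simp: kdelta_def\<close>)
  finally show ?thesis .
qed

section \<open>Irreducible representations and Schur orthogonality\<close>

text \<open>Both cardinalities are traces, of Q Q' and of Q' Q. This serves twice: for the degrees
  of equivalent representations and for the sum of the squared degrees.\<close>

lemma card_eq_of_mutually_inverse:
  assumes QQ': "\<And>x. x \<in> S \<Longrightarrow> (\<Sum>y\<in>T. Q x y * Q' y x) = (1 :: complex)"
    and Q'Q: "\<And>y. y \<in> T \<Longrightarrow> (\<Sum>x\<in>S. Q' y x * Q x y) = 1"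
  shows "card S = card T"
proof -
  have "of_nat (card S) = (\<Sum>x\<in>S. \<Sum>y\<in>T. Q x y * Q' y x)" using QQ' by simp
  also have "\<dots> = (\<Sum>y\<in>T. \<Sum>x\<in>S. Q' y x * Q x y)" by (subst sum.swap) (simp add: mult.commute)
  also have "\<dots> = of_nat (card T)" using Q'Q by simp
  finally show ?thesis using of_nat_eq_iff by blast
qed

lemma subspace_module_vec_iff:
  "subspace class_ring W (module_vec TYPE(complex) d) \<longleftrightarrow>
     W \<subseteq> carrier_vec d \<and> 0\<^sub>v d \<in> W \<and> (\<forall>v\<in>W. \<forall>w\<in>W. v + w \<in> W) \<and> (\<forall>c. \<forall>v\<in>W. c \<cdot>\<^sub>v v \<in> W)"
proof -
  interpret vec_space "TYPE(complex)" d .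
  have "vectorspace class_ring (module_vec TYPE(complex) d)" "module class_ring (module_vec TYPE(complex) d)"
    by unfold_locales
  then show ?thesis
    unfolding subspace_def submodule_def by (auto simp: module_vec_simps)
qed

text \<open>\<open>B\<close> is a linearly independent subset of \<open>W\<close> of greatest size.
  It spans \<open>W\<close>, and with \<open>d\<close> members it would be a basis of the whole
  space. The conclusion is stated in coordinates because the vectors will act as coefficient vectors
  of functions.\<close>

lemma proper_subspace_spanned:
  assumes W: "subspace class_ring W (module_vec TYPE(complex) d)" and proper: "W \<noteq> carrier_vec d"
  obtains B where "finite B" "B \<subseteq> W" "card B < d"
    "\<And>w. w \<in> W \<Longrightarrow> \<exists>a. \<forall>i<d. w $ i = (\<Sum>b\<in>B. a b * b $ i)"
proof -
  interpret vec_space "TYPE(complex)" d .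
  have Wc: "W \<subseteq> carrier_vec d" using W by (simp add: subspace_module_vec_iff)
  let ?P = "\<lambda>B. B \<subseteq> W \<and> lin_indpt B"
  have bound: "finite B \<and> card B \<le> d" if "?P B" for B
    using li_le_dim[OF fin_dim, of B] that Wc unfolding dim_is_n by auto
  have "?P {}" by (simp add: lin_dep_def)
  moreover have "\<forall>B. ?P B \<longrightarrow> card B < Suc d" using bound by (simp add: less_Suc_eq_le)
  ultimately have "\<exists>B. ?P B \<and> (\<forall>B'. ?P B' \<longrightarrow> card B' \<le> card B)"
    by (rule ex_has_greatest_nat)
  then obtain B where B: "B \<subseteq> W" "lin_indpt B" and max: "\<And>B'. ?P B' \<Longrightarrow> card B' \<le> card B"
    by metis
  have fin: "finite B" using bound B by blast
  have Bc: "B \<subseteq> carrier_vec d" using B(1) Wc by (rule subset_trans)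
  have span: "W \<subseteq> span B"
  proof
    fix w assume w: "w \<in> W"
    show "w \<in> span B"
    proof (rule ccontr)
      assume ns: "w \<notin> span B"
      have "w \<notin> B" using in_own_span[of B] Bc ns by auto
      moreover have "lin_indpt (insert w B)"
        using lin_dep_iff_in_span[of B w] B Bc w Wc ns \<open>w \<notin> B\<close> by auto
      ultimately show False using max[of "insert w B"] fin B(1) w by simp
    qed
  qed
  have "card B \<noteq> d"
  proof
    assume "card B = d"
    then have "basis B" using B Bc fin by (intro dim_li_is_basis) (simp_all add: dim_is_n)
    then have "carrier_vec d = span B" unfolding basis_def by simp
    moreover have "span B \<subseteq> W"
      using B(1) W by (intro span_is_subset) (simp_all add: subspace_def)
    ultimately show False using proper Wc by simp
  qed
  then have "card B < d" using bound B by (simp add: le_neq_implies_less)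
  moreover have "\<exists>a. \<forall>i<d. w $ i = (\<Sum>b\<in>B. a b * b $ i)" if "w \<in> W" for w
  proof -
    have "w \<in> span B" using span that by (rule subsetD)
    then obtain a where "w = lincomb a B" using finite_span[OF fin] Bc by auto
    then show ?thesis using lincomb_index[OF _ Bc] by metis
  qed
  ultimately show ?thesis by (rule that[OF fin B(1)])
qed

lemma (in group) bij_betw_mult_left: "h \<in> carrier G \<Longrightarrow> bij_betw (\<lambda>g. h \<otimes> g) (carrier G) (carrier G)"
  by (rule bij_betw_byWitness[where f' = "\<lambda>g. inv h \<otimes> g"]) (auto simp flip: m_assoc)

lemma (in group) bij_betw_mult_right: "h \<in> carrier G \<Longrightarrow> bij_betw (\<lambda>g. g \<otimes> h) (carrier G) (carrier G)"
  by (rule bij_betw_byWitness[where f' = "\<lambda>g. g \<otimes> inv h"]) (auto simp: m_assoc)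

lemma mult_mat_index_sum:
  assumes "A \<in> carrier_mat n m" "B \<in> carrier_mat m k" "i < n" "j < k"
  shows "(A * B) $$ (i, j) = (\<Sum>l<m. A $$ (i, l) * B $$ (l, j))"
  unfolding lessThan_atLeast0 using assms by (auto simp: scalar_prod_def)

lemma mult_mat_vec_unit_vec:
  fixes A :: "complex mat"
  assumes "A \<in> carrier_mat n m" "j < m"
  shows "A *\<^sub>v unit_vec m j = col A j"
  using assms by (intro eq_vecI) auto

lemma representation_carrier:
  assumes "group_representation \<Gamma> d \<rho>" "g \<in> carrier \<Gamma>"
  shows "\<rho> g \<in> carrier_mat d d"
  using assms by (auto simp: group_representation_def hom_def units_of_def Units_def ring_mat_simps)

lemma representation_mult:
  assumes "group_representation \<Gamma> d \<rho>" "g \<in> carrier \<Gamma>" "h \<in> carrier \<Gamma>"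
  shows "\<rho> (g \<otimes>\<^bsub>\<Gamma>\<^esub> h) = \<rho> g * \<rho> h"
  using assms by (auto simp: group_representation_def hom_def units_of_def ring_mat_simps)

lemma representation_mult_index:
  assumes "group_representation \<Gamma> d \<rho>" "g \<in> carrier \<Gamma>" "h \<in> carrier \<Gamma>" "a < d" "b < d"
  shows "\<rho> (g \<otimes>\<^bsub>\<Gamma>\<^esub> h) $$ (a, b) = (\<Sum>c<d. \<rho> g $$ (a, c) * \<rho> h $$ (c, b))"
  unfolding representation_mult[OF assms(1-3)] using assms
  by (intro mult_mat_index_sum) (auto intro: representation_carrier)

text \<open>The image of the unit is idempotent, and an invertible idempotent is the
  identity.\<close>

lemma (in group) representation_one:
  assumes "group_representation G d \<rho>"
  shows "\<rho> \<one> = 1\<^sub>m d"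
proof -
  have "\<rho> \<one> \<in> Units (ring_mat TYPE(complex) d ())"
    using assms by (auto simp: group_representation_def hom_def units_of_def)
  then obtain P where P: "P \<in> carrier_mat d d" "P * \<rho> \<one> = 1\<^sub>m d"
    by (auto simp: Units_def ring_mat_simps)
  have c: "\<rho> \<one> \<in> carrier_mat d d" using representation_carrier[OF assms] by auto
  have "\<rho> \<one> = P * \<rho> \<one> * \<rho> \<one>" unfolding P(2) using c by simp
  also have "\<dots> = P * (\<rho> \<one> * \<rho> \<one>)" by (rule assoc_mult_mat[OF P(1) c c])
  also have "\<dots> = 1\<^sub>m d" using representation_mult[OF assms one_closed one_closed] P by simp
  finally show ?thesis .
qed

lemma (in group) representation_inv_index:
  assumes "group_representation G d \<rho>" "g \<in> carrier G" "a < d" "b < d"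
  shows "(\<Sum>c<d. \<rho> g $$ (a, c) * \<rho> (inv g) $$ (c, b)) = kdelta a b"
    and "(\<Sum>c<d. \<rho> (inv g) $$ (a, c) * \<rho> g $$ (c, b)) = kdelta a b"
  using representation_mult_index[OF assms(1,2) inv_closed[OF assms(2)] assms(3,4)]
    representation_mult_index[OF assms(1) inv_closed[OF assms(2)] assms(2-4)] assms(2-4)
  by (simp_all add: representation_one[OF assms(1)] kdelta_def)

lemma irreducible_invariant_subspace:
  assumes "irreducible_representation \<Gamma> d \<rho>" "subspace class_ring W (module_vec TYPE(complex) d)"
    "\<forall>g\<in>carrier \<Gamma>. \<forall>w\<in>W. \<rho> g *\<^sub>v w \<in> W"
  shows "W = {0\<^sub>v d} \<or> W = carrier_vec d"
  using assms unfolding irreducible_representation_def by blast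

text \<open>Schur's lemma between two representations. The kernel of \<open>T\<close> is invariant
  and not everything, hence zero; the image is invariant and not zero, hence everything. So
  \<open>T\<close> is bijective, and equality of the degrees is part of the conclusion.\<close>

lemma nonzero_intertwiner_equivalent:
  assumes \<rho>: "irreducible_representation \<Gamma> d \<rho>" and \<sigma>: "irreducible_representation \<Gamma> d' \<sigma>"
    and T: "T \<in> carrier_mat d d'"
    and inter: "\<And>g. g \<in> carrier \<Gamma> \<Longrightarrow> T * \<sigma> g = \<rho> g * T"
    and nz: "T \<noteq> 0\<^sub>m d d'"
  shows "equivalent_representations \<Gamma> d' \<sigma> d \<rho>"
proof -
  have nz': "\<exists>v\<in>carrier_vec d'. T *\<^sub>v v \<noteq> 0\<^sub>v d"
  proof (rule ccontr)
    assume "\<not> ?thesis"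
    then have "T *\<^sub>v unit_vec d' j = 0\<^sub>v d" for j by auto
    then have "col T j = 0\<^sub>v d" if "j < d'" for j using that T mult_mat_vec_unit_vec by metis
    then have "T = 0\<^sub>m d d'" using T by (intro eq_matI) (auto simp: vec_eq_iff)
    with nz show False by simp
  qed
  have \<rho>c: "\<rho> g \<in> carrier_mat d d" and \<sigma>c: "\<sigma> g \<in> carrier_mat d' d'" if "g \<in> carrier \<Gamma>" for g
    using \<rho> \<sigma> that representation_carrier by (auto simp: irreducible_representation_def)
  have inter': "T *\<^sub>v (\<sigma> g *\<^sub>v v) = \<rho> g *\<^sub>v (T *\<^sub>v v)" if "g \<in> carrier \<Gamma>" "v \<in> carrier_vec d'" for g v
    using inter[OF that(1)] T \<rho>c \<sigma>c that by (metis assoc_mult_mat_vec)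
  have \<rho>0: "\<rho> g *\<^sub>v 0\<^sub>v d = 0\<^sub>v d" if "g \<in> carrier \<Gamma>" for g
    using \<rho>c[OF that] by (intro eq_vecI) auto
  have \<sigma>v: "\<sigma> g *\<^sub>v v \<in> carrier_vec d'" if "g \<in> carrier \<Gamma>" "v \<in> carrier_vec d'" for g v
    using \<sigma>c[OF that(1)] that(2) by simp
  let ?K = "{v \<in> carrier_vec d'. T *\<^sub>v v = 0\<^sub>v d}"
  have "?K = {0\<^sub>v d'} \<or> ?K = carrier_vec d'"
  proof -
    have "subspace class_ring ?K (module_vec TYPE(complex) d')"
      using T by (auto simp: subspace_module_vec_iff mult_add_distrib_mat_vec mult_mat_vec)
    moreover have "\<forall>g\<in>carrier \<Gamma>. \<forall>w\<in>?K. \<sigma> g *\<^sub>v w \<in> ?K"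
      using inter' \<rho>0 \<sigma>v by simp
    ultimately show ?thesis by (rule irreducible_invariant_subspace[OF \<sigma>])
  qed
  with nz' have ker: "?K = {0\<^sub>v d'}" by auto
  let ?I = "{T *\<^sub>v v | v. v \<in> carrier_vec d'}"
  have "?I = {0\<^sub>v d} \<or> ?I = carrier_vec d"
  proof -
    have "subspace class_ring ?I (module_vec TYPE(complex) d)"
      unfolding subspace_module_vec_iff
    proof (intro conjI ballI allI)
      show "0\<^sub>v d \<in> ?I" using T by (auto intro!: exI[of _ "0\<^sub>v d'"])
      show "v + w \<in> ?I" if vw: "v \<in> ?I" "w \<in> ?I" for v w
      proof -
        obtain x y where "x \<in> carrier_vec d'" "v = T *\<^sub>v x" "y \<in> carrier_vec d'" "w = T *\<^sub>v y"
          using vw by blast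
        then have "v + w = T *\<^sub>v (x + y)" "x + y \<in> carrier_vec d'"
          using T by (simp_all add: mult_add_distrib_mat_vec)
        then show ?thesis by blast
      qed
      show "c \<cdot>\<^sub>v v \<in> ?I" if v: "v \<in> ?I" for v c
      proof -
        obtain x where "x \<in> carrier_vec d'" "v = T *\<^sub>v x" using v by blast
        then have "c \<cdot>\<^sub>v v = T *\<^sub>v (c \<cdot>\<^sub>v x)" "c \<cdot>\<^sub>v x \<in> carrier_vec d'"
          using T by (simp_all add: mult_mat_vec)
        then show ?thesis by blast
      qed
    qed (use T in auto)
    moreover have "\<forall>g\<in>carrier \<Gamma>. \<forall>w\<in>?I. \<rho> g *\<^sub>v w \<in> ?I"
    proof (intro ballI)
      fix g w assume g: "g \<in> carrier \<Gamma>" and "w \<in> ?I"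
      then obtain v where "v \<in> carrier_vec d'" "w = T *\<^sub>v v" by blast
      then have "\<rho> g *\<^sub>v w = T *\<^sub>v (\<sigma> g *\<^sub>v v)" "\<sigma> g *\<^sub>v v \<in> carrier_vec d'"
        using inter'[OF g, of v] \<sigma>v[OF g] by simp_all
      then show "\<rho> g *\<^sub>v w \<in> ?I" by blast
    qed
    ultimately show ?thesis by (rule irreducible_invariant_subspace[OF \<rho>])
  qed
  moreover obtain v0 where "v0 \<in> carrier_vec d'" "T *\<^sub>v v0 \<noteq> 0\<^sub>v d" using nz' by blast
  ultimately have im: "?I = carrier_vec d" by blast
  have "\<exists>v. v \<in> carrier_vec d' \<and> T *\<^sub>v v = unit_vec d i" for i
  proof -
    have "unit_vec d i \<in> ?I" unfolding im by simp
    then show ?thesis by force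
  qed
  then obtain s where s: "\<And>i. s i \<in> carrier_vec d'" "\<And>i. T *\<^sub>v s i = unit_vec d i" by metis
  \<comment> \<open>The columns of \<open>S\<close> are preimages of the unit vectors, so
    \<open>S\<close> is a right inverse of \<open>T\<close>. It is also a left inverse because
    \<open>T\<close> annihilates the columns of \<open>S * T - 1\<close> and has zero
    kernel.\<close>
  define S where "S = mat d' d (\<lambda>(i, j). s j $ i)"
  have S: "S \<in> carrier_mat d' d" by (simp add: S_def)
  have colS: "col S j = s j" if "j < d" for j
    using that s(1)[of j] by (auto simp: S_def)
  have TS: "T * S = 1\<^sub>m d"
  proof (rule eq_matI)
    fix i j assume ij: "i < dim_row (1\<^sub>m d :: complex mat)" "j < dim_col (1\<^sub>m d :: complex mat)"
    have "(T * S) $$ (i, j) = (T *\<^sub>v s j) $ i" using ij T S colS[of j] by simp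
    then show "(T * S) $$ (i, j) = 1\<^sub>m d $$ (i, j)" using ij by (simp add: s(2))
  qed (use T S in auto)
  have ST: "S * T = 1\<^sub>m d'"
  proof -
    have "col (S * T) j = unit_vec d' j" if j: "j < d'" for j
    proof -
      have c: "col (S * T) j \<in> carrier_vec d'" using S T j by auto
      have "col (S * T) j = S *\<^sub>v col T j" by (rule col_mult2[OF S T j])
      then have "T *\<^sub>v col (S * T) j = (T * S) *\<^sub>v col T j"
        using assoc_mult_mat_vec[OF T S, of "col T j"] T j by simp
      also have "\<dots> = T *\<^sub>v unit_vec d' j" using TS T j by (simp add: mult_mat_vec_unit_vec[OF T])
      finally have "T *\<^sub>v (col (S * T) j - unit_vec d' j) = 0\<^sub>v d"
        using T c by (subst mult_minus_distrib_mat_vec[OF T]) auto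
      then have "col (S * T) j - unit_vec d' j \<in> ?K" using c by auto
      then have z: "col (S * T) j - unit_vec d' j = 0\<^sub>v d'" using ker by blast
      show ?thesis
      proof (rule eq_vecI)
        fix i assume i: "i < dim_vec (unit_vec d' j :: complex vec)"
        have "(col (S * T) j - unit_vec d' j) $ i = 0" using z i by simp
        then show "col (S * T) j $ i = unit_vec d' j $ i" using i c by simp
      qed (use c S in auto)
    qed
    then show ?thesis using S T by (intro mat_col_eqI) auto
  qed
  have "card {..<d} = card {..<d'}"
  proof (rule card_eq_of_mutually_inverse)
    show "(\<Sum>j<d'. T $$ (i, j) * S $$ (j, i)) = 1" if "i \<in> {..<d}" for i
      using mult_mat_index_sum[OF T S, of i i] TS that by simp
    show "(\<Sum>i<d. S $$ (j, i) * T $$ (i, j)) = 1" if "j \<in> {..<d'}" for j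
      using mult_mat_index_sum[OF S T, of j j] ST that by simp
  qed
  then have dd: "d' = d" by simp
  moreover have "T \<in> Units (ring_mat TYPE(complex) d ())"
    using TS ST S T dd by (auto simp: Units_def ring_mat_simps)
  ultimately show "equivalent_representations \<Gamma> d' \<sigma> d \<rho>"
    unfolding equivalent_representations_def using inter by auto
qed

text \<open>Schur's lemma for one representation: over the complex numbers \<open>T\<close> has an
  eigenvalue, and the eigenspace is invariant and nonzero, hence the whole space.\<close>

lemma intertwiner_scalar:
  assumes \<rho>: "irreducible_representation \<Gamma> d \<rho>" and T: "T \<in> carrier_mat d d"
    and inter: "\<And>g. g \<in> carrier \<Gamma> \<Longrightarrow> T * \<rho> g = \<rho> g * T"
  obtains c where "T = c \<cdot>\<^sub>m 1\<^sub>m d"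
proof -
  have "d > 0" using \<rho> by (simp add: irreducible_representation_def)
  then obtain c where "eigenvalue T c"
    using spectrum_non_empty[OF T] by (auto simp: spectrum_def)
  then obtain v where v: "v \<in> carrier_vec d" "v \<noteq> 0\<^sub>v d" "T *\<^sub>v v = c \<cdot>\<^sub>v v"
    using T by (auto simp: eigenvalue_def eigenvector_def)
  have \<rho>c: "\<rho> g \<in> carrier_mat d d" if "g \<in> carrier \<Gamma>" for g
    using \<rho> that representation_carrier by (auto simp: irreducible_representation_def)
  let ?W = "{w \<in> carrier_vec d. T *\<^sub>v w = c \<cdot>\<^sub>v w}"
  have "?W = {0\<^sub>v d} \<or> ?W = carrier_vec d"
  proof -
    have "subspace class_ring ?W (module_vec TYPE(complex) d)"
      using T by (auto simp: subspace_module_vec_iff mult_add_distrib_mat_vec mult_mat_vec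
          smult_add_distrib_vec smult_smult_assoc mult.commute)
    moreover have "\<forall>g\<in>carrier \<Gamma>. \<forall>w\<in>?W. \<rho> g *\<^sub>v w \<in> ?W"
    proof (intro ballI)
      fix g w assume g: "g \<in> carrier \<Gamma>" and w: "w \<in> ?W"
      have "T *\<^sub>v (\<rho> g *\<^sub>v w) = \<rho> g *\<^sub>v (T *\<^sub>v w)"
        using inter[OF g] T \<rho>c[OF g] w
        by (metis (no_types, lifting) assoc_mult_mat_vec mem_Collect_eq)
      then show "\<rho> g *\<^sub>v w \<in> ?W" using w \<rho>c[OF g] by (auto simp: mult_mat_vec)
    qed
    ultimately show ?thesis by (rule irreducible_invariant_subspace[OF \<rho>])
  qed
  then have W: "T *\<^sub>v w = c \<cdot>\<^sub>v w" if "w \<in> carrier_vec d" for w using v that by blast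
  have "T = c \<cdot>\<^sub>m 1\<^sub>m d"
  proof (rule eq_matI)
    fix i j assume ij: "i < dim_row (c \<cdot>\<^sub>m 1\<^sub>m d)" "j < dim_col (c \<cdot>\<^sub>m 1\<^sub>m d)"
    have "T $$ (i, j) = (T *\<^sub>v unit_vec d j) $ i" using ij T by (simp add: mult_mat_vec_unit_vec[OF T])
    also have "\<dots> = c * unit_vec d j $ i" using ij by (simp add: W)
    finally show "T $$ (i, j) = (c \<cdot>\<^sub>m 1\<^sub>m d) $$ (i, j)" using ij by auto
  qed (use T in auto)
  then show ?thesis using that by blast
qed

section \<open>Averaging over the group and Schur orthogonality\<close>

context group
begin

text \<open>\<open>T\<close> is the sum over g of \<rho>(g) E \<sigma>(g^-1), where E is the matrix
  unit at \<open>(b, c)\<close>. Replacing g by h g in this sum moves h from one side to the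
  other.\<close>

lemma averaged_intertwiner:
  assumes \<rho>: "group_representation G d \<rho>" and \<sigma>: "group_representation G d' \<sigma>"
    and bc: "b < d" "c < d'" and h: "h \<in> carrier G"
  defines "T \<equiv> mat d d' (\<lambda>(a, e). \<Sum>g\<in>carrier G. \<rho> g $$ (a, b) * \<sigma> (inv g) $$ (c, e))"
  shows "T * \<sigma> h = \<rho> h * T"
proof (rule eq_matI)
  have T: "T \<in> carrier_mat d d'" by (simp add: T_def)
  have c: "\<rho> h \<in> carrier_mat d d" "\<sigma> h \<in> carrier_mat d' d'"
    using \<rho> \<sigma> h by (auto intro: representation_carrier)
  show "dim_row (T * \<sigma> h) = dim_row (\<rho> h * T)" "dim_col (T * \<sigma> h) = dim_col (\<rho> h * T)"
    using T c by auto
  fix a e assume "a < dim_row (\<rho> h * T)" "e < dim_col (\<rho> h * T)"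
  then have ae: "a < d" "e < d'" using T c by auto
  have "(T * \<sigma> h) $$ (a, e) =
      (\<Sum>x<d'. (\<Sum>g\<in>carrier G. \<rho> g $$ (a, b) * \<sigma> (inv g) $$ (c, x)) * \<sigma> h $$ (x, e))"
    using mult_mat_index_sum[OF T c(2) ae] ae by (simp add: T_def)
  also have "\<dots> = (\<Sum>g\<in>carrier G. \<rho> g $$ (a, b) * (\<Sum>x<d'. \<sigma> (inv g) $$ (c, x) * \<sigma> h $$ (x, e)))"
    unfolding sum_distrib_left sum_distrib_right by (subst sum.swap) (simp add: mult.assoc)
  also have "\<dots> = (\<Sum>g\<in>carrier G. \<rho> g $$ (a, b) * \<sigma> (inv g \<otimes> h) $$ (c, e))"
    using bc ae h by (simp add: representation_mult_index[OF \<sigma>])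
  also have "\<dots> = (\<Sum>g\<in>carrier G. \<rho> (h \<otimes> g) $$ (a, b) * \<sigma> (inv (h \<otimes> g) \<otimes> h) $$ (c, e))"
    by (rule sum.reindex_bij_betw[OF bij_betw_mult_left[OF h], symmetric])
  also have "\<dots> = (\<Sum>g\<in>carrier G. \<rho> (h \<otimes> g) $$ (a, b) * \<sigma> (inv g) $$ (c, e))"
    using h by (auto intro!: sum.cong simp: inv_mult_group m_assoc)
  also have "\<dots> = (\<Sum>g\<in>carrier G. (\<Sum>x<d. \<rho> h $$ (a, x) * \<rho> g $$ (x, b)) * \<sigma> (inv g) $$ (c, e))"
    using bc ae h by (simp add: representation_mult_index[OF \<rho>])
  also have "\<dots> = (\<Sum>x<d. \<rho> h $$ (a, x) * (\<Sum>g\<in>carrier G. \<rho> g $$ (x, b) * \<sigma> (inv g) $$ (c, e)))"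
    unfolding sum_distrib_left sum_distrib_right by (subst sum.swap) (simp add: mult.assoc)
  also have "\<dots> = (\<rho> h * T) $$ (a, e)"
    using mult_mat_index_sum[OF c(1) T ae] ae by (simp add: T_def)
  finally show "(T * \<sigma> h) $$ (a, e) = (\<rho> h * T) $$ (a, e)" .
qed

lemma schur_orthogonality_inequivalent:
  assumes \<rho>: "irreducible_representation G d \<rho>" and \<sigma>: "irreducible_representation G d' \<sigma>"
    and ne: "\<not> equivalent_representations G d' \<sigma> d \<rho>"
    and "a < d" "b < d" "c < d'" "e < d'"
  shows "(\<Sum>g\<in>carrier G. \<rho> g $$ (a, b) * \<sigma> (inv g) $$ (c, e)) = 0"
proof -
  define T where "T = mat d d' (\<lambda>(a, e). \<Sum>g\<in>carrier G. \<rho> g $$ (a, b) * \<sigma> (inv g) $$ (c, e))"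
  have "T = 0\<^sub>m d d'"
    using nonzero_intertwiner_equivalent[OF \<rho> \<sigma>, of T] ne averaged_intertwiner[of d \<rho> d' \<sigma> b c] assms
    by (auto simp: irreducible_representation_def T_def)
  then have "T $$ (a, e) = 0" using assms by simp
  then show ?thesis using assms by (simp add: T_def)
qed

lemma schur_orthogonality:
  assumes \<rho>: "irreducible_representation G d \<rho>"
    and "a < d" "b < d" "c < d" "e < d"
  shows "(\<Sum>g\<in>carrier G. \<rho> g $$ (a, b) * \<rho> (inv g) $$ (c, e)) =
           of_nat (Coset.order G) / of_nat d * kdelta a e * kdelta b c"
proof -
  have rep: "group_representation G d \<rho>" and d: "d > 0"
    using \<rho> by (auto simp: irreducible_representation_def)
  define T where "T = mat d d (\<lambda>(a, e). \<Sum>g\<in>carrier G. \<rho> g $$ (a, b) * \<rho> (inv g) $$ (c, e))"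
  obtain k where k: "T = k \<cdot>\<^sub>m 1\<^sub>m d"
    using intertwiner_scalar[OF \<rho>, of T] averaged_intertwiner[OF rep rep] assms by (auto simp: T_def)
  \<comment> \<open>The scalar is read off from the trace: summing over the diagonal joins the two
    factors to the entry \<open>(c, b)\<close> of \<rho>(g^-1) \<rho>(g) = 1, once for every group
    element.\<close>
  have "of_nat d * k = (\<Sum>x<d. T $$ (x, x))" by (simp add: k)
  also have "\<dots> = (\<Sum>g\<in>carrier G. \<Sum>x<d. \<rho> (inv g) $$ (c, x) * \<rho> g $$ (x, b))"
    by (subst sum.swap) (simp add: T_def mult.commute)
  also have "\<dots> = of_nat (Coset.order G) * kdelta b c"
    using assms by (simp add: representation_inv_index[OF rep] Coset.order_def kdelta_def)
  finally have "k = of_nat (Coset.order G) / of_nat d * kdelta b c" using d by (simp add: field_simps)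
  moreover have "T $$ (a, e) = k * kdelta a e" using assms by (simp add: k kdelta_def)
  ultimately show ?thesis using assms by (simp add: T_def)
qed

end

section \<open>Completeness of the matrix coefficients\<close>

text \<open>A finite, not identically vanishing family of functions in \<open>K\<close> whose span is stable under
  right translation, with coefficients \<open>s\<close>.\<close>

definition (in group) translation_family ::
  "(('a \<Rightarrow> complex) \<Rightarrow> bool) \<Rightarrow> 'j set \<Rightarrow> ('j \<Rightarrow> 'a \<Rightarrow> complex) \<Rightarrow> ('a \<Rightarrow> 'j \<Rightarrow> 'j \<Rightarrow> complex) \<Rightarrow> bool"
where
  "translation_family K J b s \<longleftrightarrow> finite J \<and> (\<forall>a\<in>J. K (b a)) \<and>
     (\<forall>g\<in>carrier G. \<forall>h\<in>carrier G. \<forall>a\<in>J. b a (g \<otimes> h) = (\<Sum>c\<in>J. b c g * s h c a)) \<and>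
     (\<exists>a\<in>J. \<exists>g\<in>carrier G. b a g \<noteq> 0)"

lemma (in group) translation_family_reindex:
  assumes "translation_family K J b s"
  shows "\<exists>b' s'. translation_family K {..<card J} b' s'"
proof -
  have "finite J" using assms by (simp add: translation_family_def)
  then obtain e where e: "bij_betw e {..<card J} J"
    using ex_bij_betw_nat_finite atLeast0LessThan by metis
  have J: "e ` {..<card J} = J" using e by (simp add: bij_betw_def)
  then have eJ: "e a \<in> J" if "a \<in> {..<card J}" for a using that by (metis imageI)
  have "translation_family K {..<card J} (\<lambda>a. b (e a)) (\<lambda>h c a. s h (e c) (e a))"
    unfolding translation_family_def
  proof (intro conjI ballI)
    fix g h a assume gh: "g \<in> carrier G" "h \<in> carrier G" and "a \<in> {..<card J}"
    then have "b (e a) (g \<otimes> h) = (\<Sum>c\<in>J. b c g * s h c (e a))"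
      using assms gh eJ by (simp add: translation_family_def)
    also have "\<dots> = (\<Sum>c<card J. b (e c) g * s h (e c) (e a))"
      by (rule sum.reindex_bij_betw[OF e, symmetric])
    finally show "b (e a) (g \<otimes> h) = (\<Sum>c<card J. b (e c) g * s h (e c) (e a))" .
  next
    fix a assume "a \<in> {..<card J}"
    then show "K (b (e a))" using assms eJ by (simp add: translation_family_def)
  next
    obtain a g where "a \<in> J" "g \<in> carrier G" "b a g \<noteq> 0"
      using assms unfolding translation_family_def by blast
    moreover obtain a' where "a' < card J" "a = e a'"
      using \<open>a \<in> J\<close> J by (metis imageE lessThan_iff)
    ultimately show "\<exists>a\<in>{..<card J}. \<exists>g\<in>carrier G. b (e a) g \<noteq> 0" by auto
  qed simp
  then show ?thesis by blast
qed

text \<open>A family with the least number of members is linearly independent, and the matrices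
  describing its translates form an irreducible representation.\<close>

lemma (in group) irreducible_translation_family:
  assumes lin: "\<forall>(d :: nat) b x. (\<forall>a<d. K (b a)) \<longrightarrow> K (\<lambda>g. \<Sum>a<d. b a g * x a)"
    and ex: "translation_family K (J :: 'j set) b0 s0"
  obtains d b s where "translation_family K {..<d} b s"
    "irreducible_representation G d (\<lambda>h. mat d d (\<lambda>(c, a). s h c a))"
proof -
  define P where "P d \<longleftrightarrow> (\<exists>b s. translation_family K {..<d} b s)" for d :: nat
  define d where "d = (LEAST d. P d)"
  have "P (card J)" unfolding P_def by (rule translation_family_reindex[OF ex])
  then have "P d" unfolding d_def by (rule LeastI)
  then obtain b s where tf: "translation_family K {..<d} b s" unfolding P_def by blast
  have least: "d \<le> d'" if "P d'" for d' using that unfolding d_def by (rule Least_le)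
  \<comment> \<open>Minimality holds against families over any index type; it is used for a set of
    numbers and for a set of vectors.\<close>
  have minimal: "d \<le> card I" if "translation_family K I b' s'"
    for I :: "'i set" and b' s'
    by (rule least, unfold P_def) (rule translation_family_reindex[OF that])
  have Kb: "K (b a)" if "a < d" for a
    using tf that by (simp add: translation_family_def)
  have trans: "b a (g \<otimes> h) = (\<Sum>c<d. b c g * s h c a)"
    if "g \<in> carrier G" "h \<in> carrier G" "a < d" for g h a
    using tf that by (simp add: translation_family_def)
  obtain a1 g1 where nz: "a1 < d" "g1 \<in> carrier G" "b a1 g1 \<noteq> 0"
    using tf unfolding translation_family_def by auto
  \<comment> \<open>A nontrivial relation expresses one member through the others. Substituting it
    into the translation rule gives a family with that member dropped, which still does not vanish:
    otherwise the dropped member would vanish as well.\<close>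
  have indep: "x a = 0" if rel: "\<And>g. g \<in> carrier G \<Longrightarrow> (\<Sum>a<d. b a g * x a) = 0" and a: "a < d" for x a
  proof (rule ccontr)
    assume xa: "x a \<noteq> 0"
    define I where "I = {..<d} - {a}"
    define y where "y c = - x c / x a" for c
    have split: "(\<Sum>c<d. F c) = F a + (\<Sum>c\<in>I. F c)" for F :: "nat \<Rightarrow> complex"
      unfolding I_def using a by (intro sum.remove) auto
    have ba: "b a g = (\<Sum>c\<in>I. b c g * y c)" if "g \<in> carrier G" for g
    proof -
      have "b a g * x a = - (\<Sum>c\<in>I. b c g * x c)"
        using rel[OF that] unfolding split[of "\<lambda>c. b c g * x c"] by (simp add: eq_neg_iff_add_eq_0)
      then have "b a g = - (\<Sum>c\<in>I. b c g * x c) / x a" using xa by (metis nonzero_mult_div_cancel_right)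
      then show ?thesis by (simp add: y_def sum_divide_distrib sum_negf)
    qed
    have "translation_family K I b (\<lambda>h c e. s h c e + y c * s h a e)"
      unfolding translation_family_def
    proof (intro conjI ballI)
      show "finite I" by (simp add: I_def)
      show "K (b c)" if "c \<in> I" for c using that Kb by (simp add: I_def)
      show "b e (g \<otimes> h) = (\<Sum>c\<in>I. b c g * (s h c e + y c * s h a e))"
        if "g \<in> carrier G" "h \<in> carrier G" "e \<in> I" for g h e
      proof -
        have "b e (g \<otimes> h) = b a g * s h a e + (\<Sum>c\<in>I. b c g * s h c e)"
          using trans[OF that(1,2), of e] that(3) unfolding split[of "\<lambda>c. b c g * s h c e"]
          by (simp add: I_def)
        also have "\<dots> = (\<Sum>c\<in>I. b c g * y c * s h a e) + (\<Sum>c\<in>I. b c g * s h c e)"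
          using ba[OF that(1)] by (simp add: sum_distrib_right)
        finally show ?thesis by (simp add: sum.distrib distrib_left mult.assoc)
      qed
      show "\<exists>c\<in>I. \<exists>g\<in>carrier G. b c g \<noteq> 0"
      proof (rule ccontr)
        assume "\<not> ?thesis"
        then have z: "b c g = 0" if "c \<in> I" "g \<in> carrier G" for c g using that by blast
        then have "b a g = 0" if "g \<in> carrier G" for g using ba[OF that] that by simp
        then have "b a1 g1 = 0" using z nz by (cases "a1 = a") (auto simp: I_def)
        then show False using nz by simp
      qed
    qed
    then have "d \<le> card I" by (rule minimal)
    then show False using a by (simp add: I_def)
  qed
  have indep_eq: "x a = y a"
    if "\<And>g. g \<in> carrier G \<Longrightarrow> (\<Sum>a<d. b a g * x a) = (\<Sum>a<d. b a g * y a)" "a < d" for x y a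
    using indep[of "\<lambda>a. x a - y a" a] that by (simp add: right_diff_distrib sum_subtractf)
  define S where "S h = mat d d (\<lambda>(c, a). s h c a)" for h
  have Sc: "S h \<in> carrier_mat d d" for h by (simp add: S_def)
  have S_mult: "S (g \<otimes> h) = S g * S h" if gh: "g \<in> carrier G" "h \<in> carrier G" for g h
  proof (rule eq_matI)
    fix c a assume "c < dim_row (S g * S h)" "a < dim_col (S g * S h)"
    then have ca: "c < d" "a < d" using Sc[of g] Sc[of h] by auto
    \<comment> \<open>By independence the coefficients are determined by the functions, so two
      expansions of the translate of \<open>b a\<close> by \<open>g \<otimes> h\<close> can be
      compared term by term.\<close>
    have "s (g \<otimes> h) c a = (\<Sum>e<d. s g c e * s h e a)"
    proof (rule indep_eq[OF _ ca(1)])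
      fix x assume x: "x \<in> carrier G"
      have "(\<Sum>c<d. b c x * s (g \<otimes> h) c a) = b a (x \<otimes> g \<otimes> h)"
        using x gh ca by (simp add: trans[symmetric] m_assoc)
      also have "\<dots> = (\<Sum>e<d. (\<Sum>c<d. b c x * s g c e) * s h e a)"
        using x gh ca by (simp add: trans)
      also have "\<dots> = (\<Sum>c<d. b c x * (\<Sum>e<d. s g c e * s h e a))"
        unfolding sum_distrib_left sum_distrib_right by (subst sum.swap) (simp add: mult.assoc)
      finally show "(\<Sum>c<d. b c x * s (g \<otimes> h) c a) = (\<Sum>c<d. b c x * (\<Sum>e<d. s g c e * s h e a))" .
    qed
    then show "S (g \<otimes> h) $$ (c, a) = (S g * S h) $$ (c, a)"
      using mult_mat_index_sum[OF Sc Sc ca] ca by (simp add: S_def)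
  qed (simp_all add: S_def)
  have S_one: "S \<one> = 1\<^sub>m d"
  proof (rule eq_matI)
    fix c a assume "c < dim_row (1\<^sub>m d :: complex mat)" "a < dim_col (1\<^sub>m d :: complex mat)"
    then have ca: "c < d" "a < d" by auto
    have "s \<one> c a = kdelta c a"
      by (rule indep_eq[OF _ ca(1)]) (use ca in \<open>simp add: trans[symmetric]\<close>)
    then show "S \<one> $$ (c, a) = 1\<^sub>m d $$ (c, a)" using ca by (simp add: S_def kdelta_def)
  qed (simp_all add: S_def)
  have rep: "group_representation G d S"
    unfolding group_representation_def
  proof (rule homI)
    fix g assume g: "g \<in> carrier G"
    have "S g * S (inv g) = 1\<^sub>m d" "S (inv g) * S g = 1\<^sub>m d"
      using g by (simp_all add: S_mult[symmetric] S_one)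
    then show "S g \<in> carrier (units_of (ring_mat TYPE(complex) d ()))"
      using Sc by (auto simp: units_of_def Units_def ring_mat_simps)
  qed (simp add: S_mult units_of_def ring_mat_simps)
  have "irreducible_representation G d S"
    unfolding irreducible_representation_def
  proof (intro conjI allI impI)
    show "group_representation G d S" by (rule rep)
    show "0 < d" using nz by simp
    fix W assume "subspace class_ring W (module_vec TYPE(complex) d) \<and>
      (\<forall>g\<in>carrier G. \<forall>w\<in>W. S g *\<^sub>v w \<in> W)"
    then have W: "subspace class_ring W (module_vec TYPE(complex) d)"
      and inv: "\<And>g w. g \<in> carrier G \<Longrightarrow> w \<in> W \<Longrightarrow> S g *\<^sub>v w \<in> W" by auto
    show "W = {0\<^sub>v d} \<or> W = carrier_vec d"
    proof (rule ccontr)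
      assume "\<not> ?thesis"
      then have ne: "W \<noteq> {0\<^sub>v d}" "W \<noteq> carrier_vec d" by auto
      have Wc: "W \<subseteq> carrier_vec d" and W0: "0\<^sub>v d \<in> W" using W by (auto simp: subspace_module_vec_iff)
      obtain B where B: "finite B" "B \<subseteq> W" "card B < d"
        and span: "\<And>w. w \<in> W \<Longrightarrow> \<exists>a. \<forall>i<d. w $ i = (\<Sum>v\<in>B. a v * v $ i)"
        using proper_subspace_spanned[OF W ne(2)] by blast
      have "\<exists>a. \<forall>i<d. (S h *\<^sub>v w) $ i = (\<Sum>v\<in>B. a v * v $ i)" if "h \<in> carrier G" "w \<in> B" for h w
        using that B(2) by (intro span inv) auto
      then obtain \<kappa> where \<kappa>: "\<And>h w i. h \<in> carrier G \<Longrightarrow> w \<in> B \<Longrightarrow> i < d \<Longrightarrow>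
          (S h *\<^sub>v w) $ i = (\<Sum>v\<in>B. \<kappa> h w v * v $ i)" by metis
      \<comment> \<open>A vector w stands for the combination of the \<open>b a\<close> with
        coefficients w_a. Invariance of \<open>W\<close> keeps the translates within the span of
        those from \<open>B\<close>, and there are fewer than \<open>d\<close> of them.\<close>
      have "translation_family K B (\<lambda>w g. \<Sum>a<d. b a g * w $ a) (\<lambda>h v w. \<kappa> h w v)"
        unfolding translation_family_def
      proof (intro conjI ballI)
        show "finite B" by (rule B(1))
        show "K (\<lambda>g. \<Sum>a<d. b a g * w $ a)" for w using lin Kb by simp
        fix g h w assume gh: "g \<in> carrier G" "h \<in> carrier G" and w: "w \<in> B"
        have wc: "w \<in> carrier_vec d" using w B(2) Wc by auto
        have Sw: "(S h *\<^sub>v w) $ c = (\<Sum>a<d. s h c a * w $ a)" if "c < d" for c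
          using that wc by (simp add: S_def scalar_prod_def atLeast0LessThan)
        have "(\<Sum>a<d. b a (g \<otimes> h) * w $ a) = (\<Sum>a<d. (\<Sum>c<d. b c g * s h c a) * w $ a)"
          using gh by (simp add: trans)
        also have "\<dots> = (\<Sum>c<d. b c g * (\<Sum>a<d. s h c a * w $ a))"
          unfolding sum_distrib_left sum_distrib_right by (subst sum.swap) (simp add: mult.assoc)
        also have "\<dots> = (\<Sum>c<d. b c g * (\<Sum>v\<in>B. \<kappa> h w v * v $ c))"
          using Sw \<kappa>[OF gh(2) w] by simp
        also have "\<dots> = (\<Sum>v\<in>B. (\<Sum>c<d. b c g * v $ c) * \<kappa> h w v)"
          unfolding sum_distrib_left sum_distrib_right by (subst sum.swap) (simp add: mult_ac)
        finally show "(\<Sum>a<d. b a (g \<otimes> h) * w $ a) = (\<Sum>v\<in>B. (\<Sum>a<d. b a g * v $ a) * \<kappa> h w v)" .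
      next
        show "\<exists>w\<in>B. \<exists>g\<in>carrier G. (\<Sum>a<d. b a g * w $ a) \<noteq> 0"
        proof (rule ccontr)
          assume "\<not> ?thesis"
          then have "v $ i = 0" if "v \<in> B" "i < d" for v i
            using indep[of "\<lambda>a. v $ a" i] that by blast
          then have "w = 0\<^sub>v d" if "w \<in> W" for w
            using span[OF that] Wc that by (intro eq_vecI) auto
          then show False using ne(1) W0 by blast
        qed
      qed
      then have "d \<le> card B" by (rule minimal)
      then show False using B(3) by simp
    qed
  qed
  then show ?thesis using that[OF tf] unfolding S_def by simp
qed

text \<open>If \<open>c \<noteq> 0\<close>, the translates of its conjugate contain a family \<open>b\<close> carrying an irreducible
  representation. Each \<open>cnj b\<^sub>a\<close>, as an element of the group algebra, annihilates all irreducible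
  representations, in particular that one; applied to \<open>b\<^sub>a\<close> this gives \<open>\<Sum>\<^sub>h \<bar>b\<^sub>a(h)\<bar>\<^sup>2 = 0\<close>.\<close>

lemma (in group) irreducible_coefficients_complete:
  assumes fin: "finite (carrier G)" and irr: "all_irreducible_representations G k f \<rho>"
    and zero: "\<And>i a b. i \<in> {1..k} \<Longrightarrow> a < f i \<Longrightarrow> b < f i \<Longrightarrow>
      (\<Sum>g\<in>carrier G. c g * \<rho> i g $$ (a, b)) = 0"
    and g0: "g0 \<in> carrier G"
  shows "c g0 = 0"
proof (rule ccontr)
  assume cg0: "c g0 \<noteq> 0"
  \<comment> \<open>The conjugate is built into \<open>K\<close> so that the final sum consists of
    squared moduli. Linear combinations stay in \<open>K\<close>, as conjugation only conjugates
    their scalars.\<close>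
  define K where "K v \<longleftrightarrow> (\<forall>i\<in>{1..k}. \<forall>a<f i. \<forall>b<f i.
    (\<Sum>g\<in>carrier G. cnj (v g) * \<rho> i g $$ (a, b)) = 0)" for v
  have rep: "group_representation G (f i) (\<rho> i)" if "i \<in> {1..k}" for i
    using irr that by (auto simp: all_irreducible_representations_def irreducible_representation_def)
  have lin: "\<forall>(d :: nat) b x. (\<forall>a<d. K (b a)) \<longrightarrow> K (\<lambda>g. \<Sum>a<d. b a g * x a)"
  proof (intro allI impI, unfold K_def, intro ballI allI impI)
    fix d :: nat and b :: "nat \<Rightarrow> 'a \<Rightarrow> complex" and x i y z
    assume that: "\<forall>a<d. \<forall>i\<in>{1..k}. \<forall>y<f i. \<forall>z<f i. (\<Sum>g\<in>carrier G. cnj (b a g) * \<rho> i g $$ (y, z)) = 0"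
      and iyz: "i \<in> {1..k}" "y < f i" "z < f i"
    have "(\<Sum>g\<in>carrier G. cnj (\<Sum>a<d. b a g * x a) * \<rho> i g $$ (y, z)) =
      (\<Sum>a<d. cnj (x a) * (\<Sum>g\<in>carrier G. cnj (b a g) * \<rho> i g $$ (y, z)))"
      unfolding cnj_sum sum_distrib_left sum_distrib_right by (subst sum.swap) (simp add: mult_ac)
    also have "\<dots> = 0" using that iyz by simp
    finally show "(\<Sum>g\<in>carrier G. cnj (\<Sum>a<d. b a g * x a) * \<rho> i g $$ (y, z)) = 0" .
  qed
  \<comment> \<open>Shifting the argument of \<open>c\<close> by \<open>x\<close> multiplies the
    vanishing matrix, the sum of c(g) \<rho>_i(g), on the right by \<rho>_i(x^-1).\<close>
  have Kt: "K (\<lambda>g. cnj (c (g \<otimes> x)))" if x: "x \<in> carrier G" for x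
    unfolding K_def
  proof (intro ballI allI impI)
    fix i y z assume iyz: "i \<in> {1..k}" "y < f i" "z < f i"
    have "(\<Sum>g\<in>carrier G. cnj (cnj (c (g \<otimes> x))) * \<rho> i g $$ (y, z)) =
      (\<Sum>g\<in>carrier G. c (g \<otimes> x) * \<rho> i (g \<otimes> x \<otimes> inv x) $$ (y, z))"
      using x by (simp add: m_assoc)
    also have "\<dots> = (\<Sum>g\<in>carrier G. c g * \<rho> i (g \<otimes> inv x) $$ (y, z))"
      by (rule sum.reindex_bij_betw[OF bij_betw_mult_right[OF x]])
    also have "\<dots> = (\<Sum>g\<in>carrier G. \<Sum>e<f i. c g * \<rho> i g $$ (y, e) * \<rho> i (inv x) $$ (e, z))"
      using x iyz by (simp add: representation_mult_index[OF rep] sum_distrib_left mult.assoc)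
    also have "\<dots> = (\<Sum>e<f i. (\<Sum>g\<in>carrier G. c g * \<rho> i g $$ (y, e)) * \<rho> i (inv x) $$ (e, z))"
      unfolding sum_distrib_right by (rule sum.swap)
    also have "\<dots> = 0" using zero iyz by simp
    finally show "(\<Sum>g\<in>carrier G. cnj (cnj (c (g \<otimes> x))) * \<rho> i g $$ (y, z)) = 0" .
  qed
  \<comment> \<open>The group itself indexes this family, and translation by \<open>h\<close> only
    moves the index \<open>x\<close> to \<open>h \<otimes> x\<close>.\<close>
  have tf0: "translation_family K (carrier G) (\<lambda>x g. cnj (c (g \<otimes> x))) (\<lambda>h y x. kdelta (h \<otimes> x) y)"
    unfolding translation_family_def
  proof (intro conjI ballI)
    show "\<exists>a\<in>carrier G. \<exists>g\<in>carrier G. cnj (c (g \<otimes> a)) \<noteq> 0"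
      using cg0 g0 by (intro bexI[of _ \<one>] bexI[of _ g0]) auto
  qed (use fin Kt in \<open>simp_all add: m_assoc\<close>)
  obtain d b s where tf: "translation_family K {..<d} b s"
    and ir: "irreducible_representation G d (\<lambda>h. mat d d (\<lambda>(c, a). s h c a))"
    using irreducible_translation_family[OF lin tf0] by blast
  define S where "S h = mat d d (\<lambda>(c, a). s h c a)" for h
  obtain i where i: "i \<in> {1..k}" and "equivalent_representations G d S (f i) (\<rho> i)"
    using irr ir unfolding all_irreducible_representations_def S_def by blast
  then obtain P P' where d: "f i = d" and P: "P \<in> carrier_mat d d" "P' \<in> carrier_mat d d" "P' * P = 1\<^sub>m d"
    and inter: "\<And>g. g \<in> carrier G \<Longrightarrow> P * S g = \<rho> i g * P"
    unfolding equivalent_representations_def by (auto simp: Units_def ring_mat_simps)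
  have S_conj: "S g $$ (x, y) = (\<Sum>u<d. \<Sum>w<d. P' $$ (x, u) * \<rho> i g $$ (u, w) * P $$ (w, y))"
    if g: "g \<in> carrier G" and xy: "x < d" "y < d" for g x y
  proof -
    have Sc: "S g \<in> carrier_mat d d" by (simp add: S_def)
    have rc: "\<rho> i g \<in> carrier_mat d d" using representation_carrier[OF rep[OF i] g] d by simp
    have "S g = P' * P * S g" using P(3) Sc by simp
    also have "\<dots> = P' * (P * S g)" by (rule assoc_mult_mat[OF P(2,1) Sc])
    finally have "S g = P' * (\<rho> i g * P)" by (simp only: inter[OF g])
    moreover have "(P' * (\<rho> i g * P)) $$ (x, y) = (\<Sum>u<d. P' $$ (x, u) * (\<rho> i g * P) $$ (u, y))"
      by (rule mult_mat_index_sum[OF P(2) _ xy]) (use rc P in auto)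
    moreover have "(\<rho> i g * P) $$ (u, y) = (\<Sum>w<d. \<rho> i g $$ (u, w) * P $$ (w, y))" if "u < d" for u
      by (rule mult_mat_index_sum[OF rc P(1) that xy(2)])
    ultimately show ?thesis by (simp add: sum_distrib_left mult.assoc)
  qed
  have S_zero: "(\<Sum>g\<in>carrier G. cnj (b a g) * S g $$ (x, y)) = 0" if "a < d" "x < d" "y < d" for a x y
  proof -
    have "(\<Sum>g\<in>carrier G. cnj (b a g) * S g $$ (x, y)) =
      (\<Sum>g\<in>carrier G. \<Sum>u<d. \<Sum>w<d. P' $$ (x, u) * P $$ (w, y) * (cnj (b a g) * \<rho> i g $$ (u, w)))"
      using that by (simp add: S_conj sum_distrib_left mult_ac)
    also have "\<dots> = (\<Sum>u<d. \<Sum>w<d. \<Sum>g\<in>carrier G. P' $$ (x, u) * P $$ (w, y) * (cnj (b a g) * \<rho> i g $$ (u, w)))"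
      by (subst sum.swap) (intro sum.cong refl sum.swap)
    also have "\<dots> = (\<Sum>u<d. \<Sum>w<d. P' $$ (x, u) * P $$ (w, y) * (\<Sum>g\<in>carrier G. cnj (b a g) * \<rho> i g $$ (u, w)))"
      by (simp add: sum_distrib_left)
    also have "\<dots> = 0"
      using tf that(1) i d by (simp add: translation_family_def K_def)
    finally show ?thesis .
  qed
  have "b a g = 0" if a: "a < d" and g: "g \<in> carrier G" for a g
  proof -
    \<comment> \<open>Translating away from the unit writes \<open>b a\<close> as a combination of
      the coefficients of \<open>S\<close> with constants \<open>b c \<one>\<close>.\<close>
    have "(\<Sum>h\<in>carrier G. cnj (b a h) * b a h) =
      (\<Sum>h\<in>carrier G. cnj (b a h) * (\<Sum>c<d. b c \<one> * S h $$ (c, a)))"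
    proof (rule sum.cong)
      fix h assume h: "h \<in> carrier G"
      have "b a (\<one> \<otimes> h) = (\<Sum>c<d. b c \<one> * s h c a)"
        using tf a h one_closed unfolding translation_family_def by blast
      then show "cnj (b a h) * b a h = cnj (b a h) * (\<Sum>c<d. b c \<one> * S h $$ (c, a))"
        using h a by (simp add: S_def)
    qed simp
    also have "\<dots> = (\<Sum>c<d. b c \<one> * (\<Sum>h\<in>carrier G. cnj (b a h) * S h $$ (c, a)))"
      unfolding sum_distrib_left by (subst sum.swap) (simp add: mult_ac)
    also have "\<dots> = 0" using S_zero a by simp
    finally have "(\<Sum>h\<in>carrier G. of_real ((cmod (b a h))\<^sup>2) :: complex) = 0"
      by (simp del: of_real_power add: complex_norm_square mult.commute)
    then have "(\<Sum>h\<in>carrier G. (cmod (b a h))\<^sup>2) = 0"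
      by (metis of_real_eq_0_iff of_real_sum)
    then show ?thesis using fin g by (simp add: sum_nonneg_eq_0_iff)
  qed
  then show False using tf unfolding translation_family_def by blast
qed

section \<open>Decomposition of the regular representation\<close>

lemma kdelta_Pair: "kdelta (x, y) (x', y') = kdelta x x' * kdelta y y'"
  by (simp add: kdelta_def)

text \<open>One \<open>Q\<close> carries all \<open>R h\<close> into \<open>D h\<close>
  simultaneously. Tensored with the identity on \<open>E\<close> it therefore conjugates the two
  twisted sums, whatever the matrices \<open>W h\<close> are.\<close>

lemma idet_tensor_similar:
  assumes fin: "finite S" "finite T" "finite E"
    and QQ': "\<And>x x'. x \<in> S \<Longrightarrow> x' \<in> S \<Longrightarrow> (\<Sum>y\<in>T. Q x y * Q' y x') = kdelta x x'"
    and Q'Q: "\<And>y y'. y \<in> T \<Longrightarrow> y' \<in> T \<Longrightarrow> (\<Sum>x\<in>S. Q' y x * Q x y') = kdelta y y'"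
    and RQ: "\<And>h x y. h \<in> I \<Longrightarrow> x \<in> S \<Longrightarrow> y \<in> T \<Longrightarrow> (\<Sum>x'\<in>S. R h x x' * Q x' y) = (\<Sum>y'\<in>T. Q x y' * D h y' y)"
  shows "idet (S \<times> E) (\<lambda>(x, u) (x', v). kdelta (x, u) (x', v) - (\<Sum>h\<in>I. R h x x' * W h u v)) =
         idet (T \<times> E) (\<lambda>(y, u) (y', v). kdelta (y, u) (y', v) - (\<Sum>h\<in>I. D h y y' * W h u v))"
    (is "idet _ ?A = idet _ ?B")
proof (rule idet_similar[where Q = "\<lambda>(x, u) (y, v). Q x y * kdelta u v"
      and Q' = "\<lambda>(y, u) (x, v). Q' y x * kdelta u v"])
  have right: "(\<Sum>(y, v)\<in>Z \<times> E. F y v * (X y * kdelta v w)) = (\<Sum>y\<in>Z. F y w * X y)"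
    if "w \<in> E" for Z :: "'z set" and F X w
  proof -
    have "(\<Sum>(y, v)\<in>Z \<times> E. F y v * (X y * kdelta v w)) = (\<Sum>y\<in>Z. \<Sum>v\<in>E. (F y v * X y) * kdelta v w)"
      by (simp add: sum.cartesian_product[symmetric] mult.assoc)
    then show ?thesis using that fin by simp
  qed
  have left: "(\<Sum>(y, v)\<in>Z \<times> E. X y * kdelta w v * F y v) = (\<Sum>y\<in>Z. X y * F y w)"
    if "w \<in> E" for Z :: "'z set" and F X w
  proof -
    have "(\<Sum>(y, v)\<in>Z \<times> E. X y * kdelta w v * F y v) = (\<Sum>y\<in>Z. \<Sum>v\<in>E. (X y * F y v) * kdelta w v)"
      by (simp add: sum.cartesian_product[symmetric] mult_ac)
    then show ?thesis using that fin by simp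
  qed
  show "finite (S \<times> E)" "finite (T \<times> E)" using fin by auto
  show "(\<Sum>q\<in>T \<times> E. (case p of (x, u) \<Rightarrow> \<lambda>(y, v). Q x y * kdelta u v) q *
          (case q of (y, u) \<Rightarrow> \<lambda>(x, v). Q' y x * kdelta u v) p') = kdelta p p'"
    if pp: "p \<in> S \<times> E" "p' \<in> S \<times> E" for p p'
  proof -
    obtain x u x' v where p: "p = (x, u)" "p' = (x', v)" "x \<in> S" "u \<in> E" "x' \<in> S" "v \<in> E"
      using pp by auto
    have "(\<Sum>(y, w)\<in>T \<times> E. Q x y * kdelta u w * (Q' y x' * kdelta w v)) = (\<Sum>y\<in>T. Q x y * kdelta u v * Q' y x')"
      by (rule right) (use p in auto)
    also have "\<dots> = kdelta x x' * kdelta u v"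
      unfolding QQ'[OF p(3,5), symmetric] sum_distrib_right by (simp add: mult_ac)
    finally show ?thesis by (simp add: p kdelta_Pair case_prod_unfold)
  qed
  show "(\<Sum>q\<in>S \<times> E. (case p of (y, u) \<Rightarrow> \<lambda>(x, v). Q' y x * kdelta u v) q *
          (case q of (x, u) \<Rightarrow> \<lambda>(y, v). Q x y * kdelta u v) p') = kdelta p p'"
    if pp: "p \<in> T \<times> E" "p' \<in> T \<times> E" for p p'
  proof -
    obtain x u x' v where p: "p = (x, u)" "p' = (x', v)" "x \<in> T" "u \<in> E" "x' \<in> T" "v \<in> E"
      using pp by auto
    have "(\<Sum>(y, w)\<in>S \<times> E. Q' x y * kdelta u w * (Q y x' * kdelta w v)) = (\<Sum>y\<in>S. Q' x y * kdelta u v * Q y x')"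
      by (rule right) (use p in auto)
    also have "\<dots> = kdelta x x' * kdelta u v"
      unfolding Q'Q[OF p(3,5), symmetric] sum_distrib_right by (simp add: mult_ac)
    finally show ?thesis by (simp add: p kdelta_Pair case_prod_unfold)
  qed
  show "(\<Sum>q\<in>S \<times> E. ?A p q * (case q of (x, u) \<Rightarrow> \<lambda>(y, v). Q x y * kdelta u v) p') =
      (\<Sum>q\<in>T \<times> E. (case p of (x, u) \<Rightarrow> \<lambda>(y, v). Q x y * kdelta u v) q * ?B q p')"
    if pp: "p \<in> S \<times> E" "p' \<in> T \<times> E" for p p'
  proof -
    obtain x u y v where p: "p = (x, u)" "p' = (y, v)" "x \<in> S" "u \<in> E" "y \<in> T" "v \<in> E"
      using pp by auto
    have "(\<Sum>q\<in>S \<times> E. ?A p q * (case q of (x, u) \<Rightarrow> \<lambda>(y, v). Q x y * kdelta u v) p') =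
        (\<Sum>(x', w)\<in>S \<times> E. (kdelta (x, u) (x', w) - (\<Sum>h\<in>I. R h x x' * W h u w)) * (Q x' y * kdelta w v))"
      by (simp add: p case_prod_unfold)
    also have "\<dots> = (\<Sum>x'\<in>S. (kdelta (x, u) (x', v) - (\<Sum>h\<in>I. R h x x' * W h u v)) * Q x' y)"
      by (rule right) (use p in auto)
    also have "\<dots> = (\<Sum>x'\<in>S. kdelta x x' * (kdelta u v * Q x' y)) - (\<Sum>x'\<in>S. \<Sum>h\<in>I. R h x x' * Q x' y * W h u v)"
      unfolding left_diff_distrib sum_subtractf kdelta_Pair sum_distrib_right by (simp add: mult_ac)
    also have "\<dots> = kdelta u v * Q x y - (\<Sum>h\<in>I. (\<Sum>x'\<in>S. R h x x' * Q x' y) * W h u v)"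
      unfolding sum_distrib_right using fin p by (subst sum.swap) simp
    also have "\<dots> = kdelta u v * Q x y - (\<Sum>h\<in>I. (\<Sum>y'\<in>T. Q x y' * D h y' y) * W h u v)"
      using RQ p by simp
    also have "\<dots> = (\<Sum>y'\<in>T. kdelta y' y * (kdelta u v * Q x y')) - (\<Sum>y'\<in>T. \<Sum>h\<in>I. Q x y' * D h y' y * W h u v)"
      unfolding sum_distrib_right using fin p by (subst sum.swap) simp
    also have "\<dots> = (\<Sum>y'\<in>T. Q x y' * (kdelta (y', u) (y, v) - (\<Sum>h\<in>I. D h y' y * W h u v)))"
      unfolding right_diff_distrib sum_subtractf kdelta_Pair sum_distrib_left by (simp add: mult_ac)
    also have "\<dots> = (\<Sum>(y', w)\<in>T \<times> E. Q x y' * kdelta u w * (kdelta (y', w) (y, v) - (\<Sum>h\<in>I. D h y' y * W h w v)))"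
      by (rule left[symmetric]) (use p in auto)
    finally show ?thesis by (simp add: p case_prod_unfold)
  qed
qed

text \<open>The index \<open>((i, a), b)\<close> stands for the matrix coefficient \<open>g \<mapsto> \<rho>\<^sub>i(g)\<^sub>a\<^sub>b\<close>; the pair \<open>(i, a)\<close> numbers the copies of
  \<open>\<rho>\<^sub>i\<close> in the regular representation.\<close>

definition fourier_index :: "nat \<Rightarrow> (nat \<Rightarrow> nat) \<Rightarrow> ((nat \<times> nat) \<times> nat) set" where
  "fourier_index k f = (SIGMA t:(SIGMA i:{1..k}. {..<f i}). {..<f (fst t)})"

lemma finite_fourier_index: "finite (fourier_index k f)"
  by (auto simp: fourier_index_def)

lemma card_fourier_index: "card (fourier_index k f) = (\<Sum>i = 1..k. (f i)\<^sup>2)"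
  using sum.Sigma[of "{1..k}" "\<lambda>i. {..<f i}" "\<lambda>i _. f i"]
  by (simp add: fourier_index_def power2_eq_square case_prod_unfold)

section \<open>Fourier inversion on a finite group and the splitting of the regular
  representation\<close>

context group
begin

text \<open>Schur orthogonality, normalised: the factor is the reciprocal of Schur's constant, and
  the transposed index \<open>(b, a)\<close> matches the pairing of outer and inner indices
  there.\<close>

lemma fourier_inverse_left:
  assumes irr: "all_irreducible_representations G k f \<rho>" and fin: "finite (carrier G)"
    and "t \<in> fourier_index k f" "t' \<in> fourier_index k f"
  shows "(\<Sum>g\<in>carrier G. (case t of ((i, a), b) \<Rightarrow>
            of_nat (f i) / of_nat (Coset.order G) * \<rho> i (inv g) $$ (b, a)) *
          (case t' of ((i, a), b) \<Rightarrow> \<rho> i g $$ (a, b))) = kdelta t t'"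
proof -
  obtain i a b j c e where t: "t = ((i, a), b)" "t' = ((j, c), e)" "i \<in> {1..k}" "j \<in> {1..k}"
    "a < f i" "b < f i" "c < f j" "e < f j"
    using assms(3,4) by (auto simp: fourier_index_def)
  have ir: "irreducible_representation G (f i) (\<rho> i)" "irreducible_representation G (f j) (\<rho> j)"
    using irr t by (auto simp: all_irreducible_representations_def)
  have pos: "Coset.order G > 0" using fin by (simp add: order_gt_0_iff_finite)
  have fi: "f i > 0" using t by auto
  have "(\<Sum>g\<in>carrier G. \<rho> j g $$ (c, e) * \<rho> i (inv g) $$ (b, a)) =
      of_nat (Coset.order G) / of_nat (f i) * kdelta t t'"
  proof (cases "i = j")
    case True
    then show ?thesis
      using schur_orthogonality[OF ir(2), of c e b a] t by (simp add: kdelta_def)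
  next
    case False
    then have "\<not> equivalent_representations G (f i) (\<rho> i) (f j) (\<rho> j)"
      using irr t by (auto simp: all_irreducible_representations_def)
    then show ?thesis
      using schur_orthogonality_inequivalent[OF ir(2,1), of c e b a] t False by (simp add: kdelta_def)
  qed
  moreover have "(\<Sum>g\<in>carrier G. of_nat (f i) / of_nat (Coset.order G) * \<rho> i (inv g) $$ (b, a) * \<rho> j g $$ (c, e)) =
      of_nat (f i) / of_nat (Coset.order G) * (\<Sum>g\<in>carrier G. \<rho> j g $$ (c, e) * \<rho> i (inv g) $$ (b, a))"
    unfolding sum_distrib_left by (simp add: mult_ac)
  ultimately show ?thesis using pos fi by (simp add: t(1,2))
qed

text \<open>As the matrix of coefficients is not yet known to be square, the second inverse relation
  is not automatic. The defect \<open>c\<close> is orthogonal to all matrix coefficients by the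
  first relation, and completeness makes it vanish.\<close>

lemma fourier_inverse_right:
  assumes irr: "all_irreducible_representations G k f \<rho>" and fin: "finite (carrier G)"
    and g: "g \<in> carrier G" "g' \<in> carrier G"
  shows "(\<Sum>t\<in>fourier_index k f. (case t of ((i, a), b) \<Rightarrow> \<rho> i g $$ (a, b)) *
           (case t of ((i, a), b) \<Rightarrow> of_nat (f i) / of_nat (Coset.order G) * \<rho> i (inv g') $$ (b, a)))
         = kdelta g g'"
    (is "(\<Sum>t\<in>_. ?Q g t * ?Q' t g') = _")
proof -
  define c where "c x = (\<Sum>t\<in>fourier_index k f. ?Q g t * ?Q' t x) - kdelta g x" for x
  have "c g' = 0"
  proof (rule irreducible_coefficients_complete[OF fin irr _ g(2)])
    fix i a b assume t: "i \<in> {1..k}" "a < f i" "b < f i"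
    define s where "s = ((i, a), b)"
    have s: "s \<in> fourier_index k f" "\<And>x. \<rho> i x $$ (a, b) = ?Q x s"
      using t by (auto simp: s_def fourier_index_def)
    have "(\<Sum>x\<in>carrier G. (\<Sum>t\<in>fourier_index k f. ?Q g t * ?Q' t x) * ?Q x s) =
        (\<Sum>t\<in>fourier_index k f. ?Q g t * (\<Sum>x\<in>carrier G. ?Q' t x * ?Q x s))"
      unfolding sum_distrib_left sum_distrib_right by (subst sum.swap) (simp only: mult.assoc)
    also have "\<dots> = (\<Sum>t\<in>fourier_index k f. ?Q g t * kdelta t s)"
      using fourier_inverse_left[OF irr fin _ s(1)] by (intro sum.cong) auto
    also have "\<dots> = ?Q g s" using s(1) finite_fourier_index by simp
    finally show "(\<Sum>x\<in>carrier G. c x * \<rho> i x $$ (a, b)) = 0"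
      using g(1) fin unfolding s(2) c_def by (simp add: left_diff_distrib sum_subtractf)
  qed
  then show ?thesis unfolding c_def by simp
qed

lemma sum_degree_squares:
  assumes "all_irreducible_representations G k f \<rho>" "finite (carrier G)"
  shows "(\<Sum>i = 1..k. (f i)\<^sup>2) = Coset.order G"
  unfolding card_fourier_index[symmetric] Coset.order_def
  by (rule card_eq_of_mutually_inverse[symmetric,
        OF trans[OF fourier_inverse_right[OF assms] kdelta_refl] trans[OF fourier_inverse_left[OF assms] kdelta_refl]])

text \<open>Right translation sends \<rho>_i(g)_ab to the sum over c of \<rho>_i(g)_ac
  \<rho>_i(h)_cb. The row index a is untouched, so each of its \<open>f i\<close> values contributes
  the same block; this is the origin of the exponent.\<close>

lemma regular_representation_idet:
  assumes irr: "all_irreducible_representations G k f \<rho>" and fin: "finite (carrier G)" "finite E"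
  shows "idet (carrier G \<times> E) (\<lambda>(g, u) (g', v). kdelta (g, u) (g', v)
            - (\<Sum>h\<in>carrier G. kdelta (g \<otimes> h) g' * W h u v)) =
         (\<Prod>i = 1..k. idet ({..<f i} \<times> E) (\<lambda>(a, u) (b, v). kdelta (a, u) (b, v)
            - (\<Sum>h\<in>carrier G. \<rho> i h $$ (a, b) * W h u v)) ^ f i)"
proof -
  let ?Q = "\<lambda>g t. case t of ((i, a), b) \<Rightarrow> \<rho> i g $$ (a, b)"
  let ?D = "\<lambda>h ((i, a), b) ((j, a'), b'). kdelta (i, a) (j, a') * \<rho> i h $$ (b, b')"
  let ?I = "SIGMA i:{1..k}. {..<f i}"
  have rep: "group_representation G (f i) (\<rho> i)" if "i \<in> {1..k}" for i
    using irr that by (auto simp: all_irreducible_representations_def irreducible_representation_def)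
  have "idet (carrier G \<times> E) (\<lambda>(g, u) (g', v). kdelta (g, u) (g', v)
            - (\<Sum>h\<in>carrier G. kdelta (g \<otimes> h) g' * W h u v)) =
        idet (fourier_index k f \<times> E) (\<lambda>(t, u) (t', v). kdelta (t, u) (t', v)
            - (\<Sum>h\<in>carrier G. ?D h t t' * W h u v))"
  proof (rule idet_tensor_similar[OF fin(1) finite_fourier_index fin(2) fourier_inverse_right[OF irr fin(1)]
        fourier_inverse_left[OF irr fin(1)]])
    fix h g t assume h: "h \<in> carrier G" and g: "g \<in> carrier G" and "t \<in> fourier_index k f"
    then obtain i a b where t: "t = ((i, a), b)" "i \<in> {1..k}" "a < f i" "b < f i"
      by (auto simp: fourier_index_def)
    have "(\<Sum>t'\<in>fourier_index k f. ?Q g t' * ?D h t' t) =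
        (\<Sum>s\<in>?I. \<Sum>c<f (fst s). kdelta s (i, a) * (?Q g (s, c) * \<rho> (fst s) h $$ (c, b)))"
      unfolding fourier_index_def t(1)
      by (subst sum.Sigma) (auto simp: case_prod_unfold mult_ac intro!: sum.cong)
    also have "\<dots> = (\<Sum>c<f i. \<rho> i g $$ (a, c) * \<rho> i h $$ (c, b))"
      unfolding sum_distrib_left[symmetric] using t by simp
    also have "\<dots> = \<rho> i (g \<otimes> h) $$ (a, b)"
      using representation_mult_index[OF rep g h] t by simp
    finally show "(\<Sum>g'\<in>carrier G. kdelta (g \<otimes> h) g' * ?Q g' t) = (\<Sum>t'\<in>fourier_index k f. ?Q g t' * ?D h t' t)"
      using fin g h t by simp
  qed auto
  also have "\<dots> = idet (SIGMA s:?I. {..<f (fst s)} \<times> E) (\<lambda>(s, b, u) (s', b', v).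
      kdelta s s' * (kdelta (b, u) (b', v) - (\<Sum>h\<in>carrier G. \<rho> (fst s) h $$ (b, b') * W h u v)))"
  proof -
    have "bij_betw (\<lambda>((s, b), u). (s, (b, u))) (fourier_index k f \<times> E) (SIGMA s:?I. {..<f (fst s)} \<times> E)"
      by (rule bij_betw_byWitness[where f' = "\<lambda>(s, (b, u)). ((s, b), u)"]) (auto simp: fourier_index_def)
    then show ?thesis
      using fin finite_fourier_index
      by (subst idet_reindex[symmetric, OF _ \<open>bij_betw _ _ _\<close>])
        (auto intro!: idet_cong simp: kdelta_def sum_distrib_left case_prod_unfold)
  qed
  also have "\<dots> = (\<Prod>s\<in>?I. idet ({..<f (fst s)} \<times> E) (\<lambda>(b, u) (b', v).
      kdelta (b, u) (b', v) - (\<Sum>h\<in>carrier G. \<rho> (fst s) h $$ (b, b') * W h u v)))"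
    using fin by (subst idet_Sigma_block_diagonal) (auto simp: kdelta_def case_prod_unfold)
  also have "\<dots> = (\<Prod>i = 1..k. idet ({..<f i} \<times> E) (\<lambda>(a, u) (b, v). kdelta (a, u) (b, v)
            - (\<Sum>h\<in>carrier G. \<rho> i h $$ (a, b) * W h u v)) ^ f i)"
  proof -
    have "(\<Prod>s\<in>?I. F (fst s)) = (\<Prod>i = 1..k. F i ^ f i)" for F :: "nat \<Rightarrow> complex"
      using prod.Sigma[of "{1..k}" "\<lambda>i. {..<f i}" "\<lambda>i _. F i"] by (simp add: case_prod_unfold)
    then show ?thesis .
  qed
  finally show ?thesis .
qed

end

section \<open>The twisted bond scattering determinant\<close>

lemma sum_Times: "(\<Sum>y\<in>A \<times> B. F y) = (\<Sum>a\<in>A. \<Sum>b\<in>B. F (a, b))"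
  by (simp add: sum.cartesian_product)

lemma sum_kdelta_Times:
  assumes "finite A" "finite B" "x \<in> B"
  shows "(\<Sum>a\<in>A. \<Sum>b\<in>B. F a b * kdelta x b) = (\<Sum>a\<in>A. F a x)"
  using assms by simp

lemma idet_scalar:
  assumes "finite S"
  shows "idet S (\<lambda>x y. kdelta x y * c) = c ^ card S"
  using idet_diagonal[OF assms, of "\<lambda>_. c"] by simp

lemma idet_kdelta: "finite S \<Longrightarrow> idet S kdelta = 1"
  using idet_scalar[of S 1] by simp

lemma idet_uminus:
  assumes "finite S"
  shows "idet S (\<lambda>x y. - F x y) = (-1) ^ card S * idet S F"
proof -
  have "idet S (\<lambda>x y. - F x y) = idet S (\<lambda>x z. \<Sum>y\<in>S. (kdelta x y * (-1)) * F y z)"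
    using assms by (intro idet_cong) (auto simp: sum_negf)
  then show ?thesis by (simp only: idet_mult[OF assms] idet_scalar[OF assms])
qed

text \<open>\<open>P\<close> collects the arcs along which a numbering of the vertices increases;
  without loops each arc or its reverse does so.\<close>

lemma arc_orientation:
  assumes fin: "finite E" and sym: "\<And>e. e \<in> E \<Longrightarrow> prod.swap e \<in> E" and irrefl: "\<And>e. e \<in> E \<Longrightarrow> fst e \<noteq> snd e"
  obtains P where "E = P \<union> prod.swap ` P" "P \<inter> prod.swap ` P = {}"
proof -
  let ?V = "fst ` E \<union> snd ` E"
  have "finite ?V" using fin by simp
  then obtain \<phi> :: "'a \<Rightarrow> nat" where inj: "inj_on \<phi> ?V"
    using finite_imp_inj_to_nat_seg by metis
  let ?P = "{e \<in> E. \<phi> (fst e) < \<phi> (snd e)}"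
  have "E \<subseteq> ?P \<union> prod.swap ` ?P"
  proof
    fix e assume e: "e \<in> E"
    then have "\<phi> (fst e) \<noteq> \<phi> (snd e)" using inj_onD[OF inj, of "fst e" "snd e"] irrefl[OF e] by blast
    then consider "\<phi> (fst e) < \<phi> (snd e)" | "\<phi> (snd e) < \<phi> (fst e)" by linarith
    then show "e \<in> ?P \<union> prod.swap ` ?P"
    proof cases
      case 2
      then have "prod.swap e \<in> ?P" using sym[OF e] by simp
      then have "prod.swap (prod.swap e) \<in> prod.swap ` ?P" by (rule imageI)
      then show ?thesis by simp
    qed (use e in simp)
  qed
  moreover have "?P \<union> prod.swap ` ?P \<subseteq> E" using sym by auto
  moreover have "?P \<inter> prod.swap ` ?P = {}" by auto
  ultimately show ?thesis using that[of ?P] by blast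
qed

text \<open>\<open>r e\<close> stands for the matrix of the voltage of \<open>e\<close>. In place of
  the group there is only \<open>twist_inverse\<close>: reversing an arc inverts its matrix, whence
  the twisted reversal is an involution.\<close>

locale twisted_arcs =
  fixes E :: "('a \<times> 'a) set" and d :: nat and r :: "'a \<times> 'a \<Rightarrow> nat \<Rightarrow> nat \<Rightarrow> complex"
  assumes finite_arcs: "finite E" and arcs_sym: "\<And>e. e \<in> E \<Longrightarrow> prod.swap e \<in> E"
    and arcs_irrefl: "\<And>e. e \<in> E \<Longrightarrow> fst e \<noteq> snd e"
    and twist_inverse: "\<And>e a c. e \<in> E \<Longrightarrow> a < d \<Longrightarrow> c < d \<Longrightarrow>
      (\<Sum>b<d. r e a b * r (prod.swap e) b c) = kdelta a c"
begin

text \<open>This is the matrix 1 - i J, not J itself.\<close>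

definition reversal :: "nat \<times> 'a \<times> 'a \<Rightarrow> nat \<times> 'a \<times> 'a \<Rightarrow> complex" where
  "reversal = (\<lambda>(a, e) (b, f). kdelta (a, e) (b, f) - \<i> * (r e a b * kdelta (prod.swap e) f))"

lemma reversal_mult:
  assumes "a < d" "e \<in> E"
  shows "(\<Sum>y\<in>{..<d} \<times> E. reversal (a, e) y * L y) =
    L (a, e) - \<i> * (\<Sum>b<d. r e a b * L (b, prod.swap e))"
proof -
  have "(\<Sum>y\<in>{..<d} \<times> E. reversal (a, e) y * L y) =
    (\<Sum>y\<in>{..<d} \<times> E. kdelta (a, e) y * L y) - \<i> * (\<Sum>b<d. \<Sum>f\<in>E. (r e a b * L (b, f)) * kdelta (prod.swap e) f)"
    unfolding sum_Times reversal_def prod.case left_diff_distrib sum_subtractf sum_distrib_left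
    by (simp add: mult_ac)
  moreover have "(\<Sum>b<d. \<Sum>f\<in>E. (r e a b * L (b, f)) * kdelta (prod.swap e) f) = (\<Sum>b<d. r e a b * L (b, prod.swap e))"
    using finite_arcs arcs_sym assms by (intro sum_kdelta_Times) auto
  ultimately show ?thesis using finite_arcs assms by simp
qed

text \<open>Orienting the edges splits the matrix into blocks with identities on the diagonal;
  block elimination leaves an identity block and twice an identity block.\<close>

lemma idet_reversal:
  assumes m: "card E = 2 * m"
  shows "idet ({..<d} \<times> E) reversal = 2 ^ (m * d)"
proof -
  obtain P where E: "E = P \<union> prod.swap ` P" and disj: "P \<inter> prod.swap ` P = {}"
    using arc_orientation[OF finite_arcs arcs_sym arcs_irrefl] by metis
  define N where "N = prod.swap ` P"
  have EPN: "E = P \<union> N" and PN: "P \<inter> N = {}" using E disj by (auto simp: N_def)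
  have swap: "e \<in> P \<Longrightarrow> prod.swap e \<in> N" "e \<in> N \<Longrightarrow> prod.swap e \<in> P" for e
    by (auto simp: N_def)
  have fin: "finite P" "finite N" using finite_arcs EPN by auto
  have "card N = card P" unfolding N_def by (intro card_image) simp
  then have cN: "card N = m" using card_Un_disjoint[OF fin PN] m EPN by simp
  \<comment> \<open>\<open>L\<close> agrees with 1 + i J on the rows over \<open>P\<close> and with
    the identity on the rows over \<open>N\<close>. It is unitriangular for the order
    \<open>N\<close>, \<open>P\<close>.\<close>
  define L :: "nat \<times> 'a \<times> 'a \<Rightarrow> nat \<times> 'a \<times> 'a \<Rightarrow> complex" where
    "L = (\<lambda>(a, e) (b, f). kdelta (a, e) (b, f) + (if e \<in> P then \<i> * (r e a b * kdelta (prod.swap e) f) else 0))"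
  have split: "{..<d} \<times> E = {..<d} \<times> P \<union> {..<d} \<times> N" "{..<d} \<times> E = {..<d} \<times> N \<union> {..<d} \<times> P"
    using EPN by auto
  have kd0: "kdelta x y = 0" if "x \<noteq> y" for x y :: "'z" using that by (simp add: kdelta_def)
  have disjD: "e \<noteq> f" if "e \<in> P" "f \<in> N" for e f using that PN by auto
  have "idet ({..<d} \<times> E) L = idet ({..<d} \<times> N) L * idet ({..<d} \<times> P) L"
    unfolding split(2)
  proof (rule idet_block_triangular)
    show "L x y = 0" if xy: "x \<in> {..<d} \<times> N" "y \<in> {..<d} \<times> P" for x y
    proof -
      obtain a e b f where "x = (a, e)" "y = (b, f)" "e \<in> N" "f \<in> P" using xy by auto
      then show ?thesis using PN by (auto simp: L_def kdelta_def)
    qed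
  qed (use fin PN in auto)
  also have "idet ({..<d} \<times> N) L = idet ({..<d} \<times> N) kdelta"
    using fin PN by (intro idet_cong) (auto simp: L_def)
  also have "idet ({..<d} \<times> P) L = idet ({..<d} \<times> P) kdelta"
  proof (intro idet_cong)
    show "L x y = kdelta x y" if xy: "x \<in> {..<d} \<times> P" "y \<in> {..<d} \<times> P" for x y
    proof -
      obtain a e b f where "x = (a, e)" "y = (b, f)" "e \<in> P" "f \<in> P" using xy by auto
      moreover have "prod.swap e \<noteq> f" using disjD[of f "prod.swap e"] swap calculation by auto
      ultimately show ?thesis by (simp add: L_def kd0)
    qed
  qed (use fin in auto)
  finally have detL: "idet ({..<d} \<times> E) L = 1" using fin by (simp add: idet_kdelta)
  define M where "M x z = (\<Sum>y\<in>{..<d} \<times> E. reversal x y * L y z)" for x z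
  have MP: "M (a, e) (c, f) = kdelta (a, e) (c, f)" if "a < d" "c < d" "e \<in> P" for a e c f
  proof -
    have sw: "prod.swap e \<notin> P" using swap(1)[OF that(3)] PN by auto
    have "(\<Sum>b<d. r e a b * L (b, prod.swap e) (c, f)) = (\<Sum>b<d. (r e a b * kdelta (prod.swap e) f) * kdelta b c)"
      using sw by (simp add: L_def kdelta_Pair mult_ac)
    also have "\<dots> = r e a c * kdelta (prod.swap e) f" using that by simp
    finally show ?thesis
      using that EPN reversal_mult[of a e "\<lambda>y. L y (c, f)"] by (simp add: M_def L_def)
  qed
  \<comment> \<open>The 2 is 1 - i * i: going along an arc of \<open>N\<close> and back through the
    modified rows over \<open>P\<close> returns to the start, where the twists cancel.\<close>
  have MN: "M (a, e) (c, f) = kdelta (a, e) (c, f) * 2 - \<i> * (r e a c * kdelta (prod.swap e) f)"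
    if "a < d" "c < d" "e \<in> N" for a e c f
  proof -
    have sw: "e \<notin> P" "prod.swap e \<in> P" using swap(2)[OF that(3)] that(3) PN by auto
    have "(\<Sum>b<d. r e a b * L (b, prod.swap e) (c, f)) =
        (\<Sum>b<d. (r e a b * kdelta (prod.swap e) f) * kdelta b c + \<i> * ((r e a b * r (prod.swap e) b c) * kdelta e f))"
      using sw by (simp add: L_def kdelta_Pair distrib_left mult_ac)
    also have "\<dots> = (\<Sum>b<d. (r e a b * kdelta (prod.swap e) f) * kdelta b c)
        + \<i> * ((\<Sum>b<d. r e a b * r (prod.swap e) b c) * kdelta e f)"
      unfolding sum.distrib sum_distrib_left sum_distrib_right by simp
    also have "\<dots> = r e a c * kdelta (prod.swap e) f + \<i> * kdelta (a, e) (c, f)"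
      using that EPN twist_inverse[of e a c] by (simp add: kdelta_Pair)
    finally show ?thesis
      using that EPN sw reversal_mult[of a e "\<lambda>y. L y (c, f)"]
      by (simp add: M_def L_def algebra_simps)
  qed
  have "idet ({..<d} \<times> E) M = idet ({..<d} \<times> P) M * idet ({..<d} \<times> N) M"
    unfolding split(1)
  proof (rule idet_block_triangular)
    show "M x y = 0" if xy: "x \<in> {..<d} \<times> P" "y \<in> {..<d} \<times> N" for x y
    proof -
      obtain a e b f where "x = (a, e)" "y = (b, f)" "a < d" "b < d" "e \<in> P" "f \<in> N" using xy by auto
      then show ?thesis using PN by (auto simp: MP kdelta_def)
    qed
  qed (use fin PN in auto)
  also have "idet ({..<d} \<times> P) M = idet ({..<d} \<times> P) kdelta"
    using fin by (intro idet_cong) (auto simp: MP)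
  also have "idet ({..<d} \<times> N) M = idet ({..<d} \<times> N) (\<lambda>x y. kdelta x y * 2)"
  proof (intro idet_cong)
    show "M x y = kdelta x y * 2" if xy: "x \<in> {..<d} \<times> N" "y \<in> {..<d} \<times> N" for x y
    proof -
      obtain a e b f where xyz: "x = (a, e)" "y = (b, f)" "a < d" "b < d" "e \<in> N" "f \<in> N" using xy by auto
      then have "prod.swap e \<noteq> f" using disjD[of "prod.swap e" f] swap by auto
      then show ?thesis using xyz by (simp add: MN kd0)
    qed
  qed (use fin in auto)
  finally have "idet ({..<d} \<times> E) M = 2 ^ (m * d)"
    using fin by (simp add: idet_kdelta idet_scalar card_cartesian_product cN mult.commute[of m])
  moreover have "idet ({..<d} \<times> E) M = idet ({..<d} \<times> E) reversal * idet ({..<d} \<times> E) L"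
    unfolding M_def using finite_arcs by (intro idet_mult) auto
  ultimately show ?thesis using detL by simp
qed

lemma idet_bond_scattering:
  fixes w :: "'a \<times> 'a \<Rightarrow> complex" and D :: "'a \<Rightarrow> complex"
  assumes fV: "finite V" and EV: "E \<subseteq> V \<times> V" and D: "\<And>v. v \<in> V \<Longrightarrow> D v \<noteq> 0"
    and m: "card E = 2 * m"
  shows "idet ({..<d} \<times> E) (\<lambda>(a, e) (b, f). kdelta (a, e) (b, f) - r e a b *
            (if snd e = fst f then \<i> * kdelta (prod.swap e) f - 2 * (w e * w f / D (snd e)) else 0)) =
         2 ^ (m * d) / (\<Prod>v\<in>V. D v) ^ d *
         idet ({..<d} \<times> V) (\<lambda>(b, u) (c, v).
            kdelta (b, u) (c, v) * (D u + \<i> * (\<Sum>f\<in>{f \<in> E. fst f = u}. w f * w (prod.swap f)))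
            + (if (u, v) \<in> E then (w (u, v))\<^sup>2 * r (u, v) b c else 0))"
    (is "?lhs = _ * ?rhs")
proof -
  \<comment> \<open>In the notation of the overview \<open>X\<close> is (1 + i J) A D^-1 and
    \<open>Y\<close> is B, so that (1 - i J) (1 + X Y) = 1 - i J + 2 A D^-1 B. The second summand of
    \<open>X\<close> comes from J A, where the twists of an arc and its reverse have
    cancelled.\<close>
  define X :: "nat \<times> 'a \<times> 'a \<Rightarrow> nat \<times> 'a \<Rightarrow> complex" where
    "X = (\<lambda>(a, e) (b, v). (r e a b * w e * kdelta (snd e) v + \<i> * (kdelta a b * w (prod.swap e) * kdelta (fst e) v)) / D v)"
  define Y :: "nat \<times> 'a \<Rightarrow> nat \<times> 'a \<times> 'a \<Rightarrow> complex" where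
    "Y = (\<lambda>(b, v) (c, f). kdelta b c * w f * kdelta (fst f) v)"
  have fin: "finite ({..<d} \<times> E)" "finite ({..<d} \<times> V)" using finite_arcs fV by auto
  have inV: "fst e \<in> V" "snd e \<in> V" if "e \<in> E" for e using that EV by auto
  define XY where "XY x z = (\<Sum>y\<in>{..<d} \<times> V. X x y * Y y z)" for x z
  have XY: "XY (a, e) (c, f) = X (a, e) (c, fst f) * w f"
    if "a < d" "c < d" "e \<in> E" "f \<in> E" for a e c f
  proof -
    have "XY (a, e) (c, f) = (\<Sum>b<d. \<Sum>v\<in>V. (X (a, e) (b, v) * kdelta b c * w f) * kdelta (fst f) v)"
      unfolding XY_def sum_Times by (simp add: Y_def mult_ac)
    also have "\<dots> = (\<Sum>b<d. X (a, e) (b, fst f) * kdelta b c * w f)"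
      using fV inV[OF that(4)] by (intro sum_kdelta_Times) auto
    also have "\<dots> = (\<Sum>b<d. (X (a, e) (b, fst f) * w f) * kdelta b c)"
      by (simp add: mult_ac)
    also have "\<dots> = X (a, e) (c, fst f) * w f" using that by simp
    finally show ?thesis .
  qed
  have "?lhs = idet ({..<d} \<times> E) (\<lambda>x z. \<Sum>y\<in>{..<d} \<times> E. reversal x y * (kdelta y z + XY y z))"
  proof (rule idet_cong[OF fin(1)])
    fix x z assume "x \<in> {..<d} \<times> E" "z \<in> {..<d} \<times> E"
    then obtain a e c f where x: "x = (a, e)" "z = (c, f)" "a < d" "e \<in> E" "c < d" "f \<in> E" by auto
    have sw: "prod.swap e \<in> E" using arcs_sym x by simp
    have 1: "(\<Sum>b<d. r e a b * kdelta (b, prod.swap e) (c, f)) = r e a c * kdelta (prod.swap e) f"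
    proof -
      have "(\<Sum>b<d. r e a b * kdelta (b, prod.swap e) (c, f)) = (\<Sum>b<d. (r e a b * kdelta (prod.swap e) f) * kdelta b c)"
        by (simp add: kdelta_Pair mult_ac)
      then show ?thesis using x by simp
    qed
    have 2: "(\<Sum>b<d. r e a b * XY (b, prod.swap e) (c, f)) =
      (kdelta a c * w (prod.swap e) * kdelta (fst e) (fst f) + \<i> * (r e a c * w e * kdelta (snd e) (fst f))) / D (fst f) * w f"
    proof -
      have "(\<Sum>b<d. r e a b * XY (b, prod.swap e) (c, f)) =
        (\<Sum>b<d. (r e a b * r (prod.swap e) b c) * (w (prod.swap e) * kdelta (fst e) (fst f) * (w f / D (fst f)))
           + (r e a b * (\<i> * w e * kdelta (snd e) (fst f) * (w f / D (fst f)))) * kdelta b c)"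
        using x sw by (intro sum.cong) (auto simp: XY X_def add_divide_distrib algebra_simps)
      also have "\<dots> = (\<Sum>b<d. r e a b * r (prod.swap e) b c) * (w (prod.swap e) * kdelta (fst e) (fst f) * (w f / D (fst f)))
           + (\<Sum>b<d. (r e a b * (\<i> * w e * kdelta (snd e) (fst f) * (w f / D (fst f)))) * kdelta b c)"
        unfolding sum.distrib sum_distrib_right by simp
      also have "\<dots> = kdelta a c * (w (prod.swap e) * kdelta (fst e) (fst f) * (w f / D (fst f)))
           + r e a c * (\<i> * w e * kdelta (snd e) (fst f) * (w f / D (fst f)))"
        using x by (simp only: twist_inverse[OF x(4,3,5)] sum_kdelta(4)[OF finite_lessThan] lessThan_iff if_True)
      finally show ?thesis by (simp add: add_divide_distrib algebra_simps)
    qed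
    have "(\<Sum>y\<in>{..<d} \<times> E. reversal x y * (kdelta y z + XY y z)) =
      kdelta (a, e) (c, f) + XY (a, e) (c, f) - \<i> * ((\<Sum>b<d. r e a b * kdelta (b, prod.swap e) (c, f))
        + (\<Sum>b<d. r e a b * XY (b, prod.swap e) (c, f)))"
      using reversal_mult[of a e "\<lambda>y. kdelta y z + XY y z"] x
      by (simp add: distrib_left sum.distrib)
    also have "\<dots> = kdelta (a, e) (c, f) - \<i> * (r e a c * kdelta (prod.swap e) f)
       + 2 * (r e a c * w e * kdelta (snd e) (fst f) / D (fst f) * w f)"
      unfolding 1 2 using x by (simp add: XY X_def add_divide_distrib algebra_simps)
    also have "\<dots> = kdelta (a, e) (c, f) - r e a c *
            (if snd e = fst f then \<i> * kdelta (prod.swap e) f - 2 * (w e * w f / D (snd e)) else 0)"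
    proof (cases "snd e = fst f")
      case False
      then have "prod.swap e \<noteq> f" by auto
      then show ?thesis using False by (simp add: kdelta_def)
    qed (simp add: algebra_simps)
    finally show "(case x of (a, e) \<Rightarrow> \<lambda>(b, f). kdelta (a, e) (b, f) - r e a b *
            (if snd e = fst f then \<i> * kdelta (prod.swap e) f - 2 * (w e * w f / D (snd e)) else 0)) z =
       (\<Sum>y\<in>{..<d} \<times> E. reversal x y * (kdelta y z + XY y z))"
      by (simp add: x)
  qed
  also have "\<dots> = 2 ^ (m * d) * idet ({..<d} \<times> E) (\<lambda>y z. kdelta y z + XY y z)"
    by (simp only: idet_mult[OF fin(1)] idet_reversal[OF m])
  also have "idet ({..<d} \<times> E) (\<lambda>y z. kdelta y z + XY y z) =
      idet ({..<d} \<times> V) (\<lambda>y y'. kdelta y y' + (\<Sum>x\<in>{..<d} \<times> E. Y y x * X x y'))"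
    unfolding XY_def by (rule idet_one_add_mult_commute[OF fin])
  finally have main: "?lhs = 2 ^ (m * d) * idet ({..<d} \<times> V) (\<lambda>y y'. kdelta y y' + (\<Sum>x\<in>{..<d} \<times> E. Y y x * X x y'))" .
  \<comment> \<open>The denominators in \<open>X\<close> depend on the column only; multiplying by
    the diagonal matrix of the \<open>D v\<close> from the right removes them.\<close>
  have "?rhs = idet ({..<d} \<times> V) (\<lambda>y z. \<Sum>y'\<in>{..<d} \<times> V.
      (kdelta y y' + (\<Sum>x\<in>{..<d} \<times> E. Y y x * X x y')) * (kdelta y' z * D (snd z)))"
  proof (rule idet_cong[OF fin(2)])
    fix y z assume yz: "y \<in> {..<d} \<times> V" "z \<in> {..<d} \<times> V"
    then obtain b u c v where x: "y = (b, u)" "z = (c, v)" "b < d" "u \<in> V" "c < d" "v \<in> V" by auto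
    have "(\<Sum>x\<in>{..<d} \<times> E. Y y x * X x z) = (\<Sum>a<d. \<Sum>e\<in>E. (w e * kdelta (fst e) u * X (a, e) (c, v)) * kdelta b a)"
      unfolding sum_Times by (simp add: x Y_def mult_ac)
    also have "\<dots> = (\<Sum>e\<in>E. w e * kdelta (fst e) u * X (b, e) (c, v))"
      using x by (subst sum.swap) simp
    \<comment> \<open>Of the arcs leaving \<open>u\<close>, the first part of \<open>X\<close> keeps
      only \<open>(u, v)\<close> itself. The reversed part leads back to \<open>u\<close>, so it
      contributes only for \<open>v = u\<close>, but from all these arcs.\<close>
    also have "\<dots> = (\<Sum>e\<in>E. (kdelta e (u, v) * ((w e)\<^sup>2 * r e b c) + (if fst e = u then \<i> * (kdelta b c * kdelta u v) * (w e * w (prod.swap e)) else 0)) / D v)"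
    proof (rule sum.cong)
      fix e assume "e \<in> E"
      have "kdelta (fst e) u * kdelta (snd e) v = kdelta e (u, v)" by (cases e) (simp add: kdelta_Pair)
      then show "w e * kdelta (fst e) u * X (b, e) (c, v) = (kdelta e (u, v) * ((w e)\<^sup>2 * r e b c) + (if fst e = u then \<i> * (kdelta b c * kdelta u v) * (w e * w (prod.swap e)) else 0)) / D v"
        by (cases "fst e = u") (auto simp: X_def power2_eq_square kdelta_def algebra_simps)
    qed simp
    also have "\<dots> = ((if (u, v) \<in> E then (w (u, v))\<^sup>2 * r (u, v) b c else 0) +
        \<i> * (kdelta b c * kdelta u v) * (\<Sum>f\<in>{f \<in> E. fst f = u}. w f * w (prod.swap f))) / D v"
      unfolding sum_divide_distrib[symmetric] sum.distrib
      using finite_arcs by (simp add: sum.inter_filter[symmetric] sum_distrib_left)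
    finally have YX: "(\<Sum>x\<in>{..<d} \<times> E. Y y x * X x z) * D v =
        (if (u, v) \<in> E then (w (u, v))\<^sup>2 * r (u, v) b c else 0) +
        \<i> * (kdelta b c * kdelta u v) * (\<Sum>f\<in>{f \<in> E. fst f = u}. w f * w (prod.swap f))"
      using D x by simp
    have "(\<Sum>y'\<in>{..<d} \<times> V. (kdelta y y' + (\<Sum>x\<in>{..<d} \<times> E. Y y x * X x y')) * (kdelta y' z * D (snd z))) =
        (\<Sum>y'\<in>{..<d} \<times> V. kdelta y' z * ((kdelta y y' + (\<Sum>x\<in>{..<d} \<times> E. Y y x * X x y')) * D (snd z)))"
      by (simp only: mult_ac)
    also have "\<dots> = kdelta y z * D v + (\<Sum>x\<in>{..<d} \<times> E. Y y x * X x z) * D v"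
      using fin(2) yz by (simp add: x(2) distrib_right)
    also have "kdelta y z * D v = kdelta y z * D u"
      by (auto simp: x kdelta_def)
    finally show "(case y of (b, u) \<Rightarrow> \<lambda>(c, v).
            kdelta (b, u) (c, v) * (D u + \<i> * (\<Sum>f\<in>{f \<in> E. fst f = u}. w f * w (prod.swap f)))
            + (if (u, v) \<in> E then (w (u, v))\<^sup>2 * r (u, v) b c else 0)) z =
        (\<Sum>y'\<in>{..<d} \<times> V. (kdelta y y' + (\<Sum>x\<in>{..<d} \<times> E. Y y x * X x y')) * (kdelta y' z * D (snd z)))"
      unfolding YX by (simp add: x kdelta_Pair algebra_simps)
  qed
  also have "\<dots> = idet ({..<d} \<times> V) (\<lambda>y y'. kdelta y y' + (\<Sum>x\<in>{..<d} \<times> E. Y y x * X x y')) * (\<Prod>z\<in>{..<d} \<times> V. D (snd z))"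
    unfolding idet_mult[OF fin(2)] idet_diagonal[OF fin(2)] ..
  also have "(\<Prod>z\<in>{..<d} \<times> V. D (snd z)) = (\<Prod>v\<in>V. D v) ^ d"
    using prod.cartesian_product[of "\<lambda>_ v. D v" V "{..<d}"] by (simp add: case_prod_unfold)
  finally have "?rhs = idet ({..<d} \<times> V) (\<lambda>y y'. kdelta y y' + (\<Sum>x\<in>{..<d} \<times> E. Y y x * X x y')) * (\<Prod>v\<in>V. D v) ^ d" .
  moreover have "(\<Prod>v\<in>V. D v) ^ d \<noteq> 0" using D fV by simp
  ultimately show ?thesis unfolding main by (simp add: field_simps)
qed

end

section \<open>Kronecker products as matrices over pairs\<close>

lemma finsum_mat:
  assumes "finite A" "\<And>g. g \<in> A \<Longrightarrow> M g \<in> carrier_mat nr nc"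
  shows "(\<Oplus>\<^bsub>module_mat TYPE(complex) nr nc\<^esub> g \<in> A. M g) = mat nr nc (\<lambda>ij. \<Sum>g\<in>A. M g $$ ij)"
  using assms
proof (induction A)
  interpret abelian_group "module_mat TYPE(complex) nr nc" by (rule abelian_group_mat)
  case empty
  show ?case by (auto simp: module_mat_simps intro!: eq_matI)
next
  interpret abelian_group "module_mat TYPE(complex) nr nc" by (rule abelian_group_mat)
  case (insert g A)
  have "(\<Oplus>\<^bsub>module_mat TYPE(complex) nr nc\<^esub> g \<in> insert g A. M g) =
      M g + (\<Oplus>\<^bsub>module_mat TYPE(complex) nr nc\<^esub> g \<in> A. M g)"
    using insert by (subst finsum_insert) (auto simp: module_mat_simps)
  also have "\<dots> = M g + mat nr nc (\<lambda>ij. \<Sum>g\<in>A. M g $$ ij)"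
    using insert by simp
  also have "\<dots> = mat nr nc (\<lambda>ij. \<Sum>g\<in>insert g A. M g $$ ij)"
    using insert.hyps insert.prems[of g] by (intro eq_matI) auto
  finally show ?case .
qed

text \<open>\<open>List.product\<close> is lexicographic, and position i of it carries the pair of i
  div and i mod the length of \<open>xs\<close>, as in the Kronecker product.\<close>

lemma kronecker_index_mat:
  assumes "A \<in> carrier_mat d d"
  shows "A \<otimes>\<^sub>K index_mat xs F = index_mat (List.product [0..<d] xs) (\<lambda>(a, x) (b, y). A $$ (a, b) * F x y)"
proof (rule eq_matI)
  fix i j
  assume "i < dim_row (index_mat (List.product [0..<d] xs) (\<lambda>(a, x) (b, y). A $$ (a, b) * F x y))"
    "j < dim_col (index_mat (List.product [0..<d] xs) (\<lambda>(a, x) (b, y). A $$ (a, b) * F x y))"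
  then have ij: "i < d * length xs" "j < d * length xs" by (simp_all add: index_mat_def)
  then have "i div length xs < d" "j div length xs < d" "0 < length xs"
    by (auto simp: less_mult_imp_div_less)
  then show "(A \<otimes>\<^sub>K index_mat xs F) $$ (i, j) =
      index_mat (List.product [0..<d] xs) (\<lambda>(a, x) (b, y). A $$ (a, b) * F x y) $$ (i, j)"
    using ij assms by (simp add: kronecker_def index_mat_def product_nth)
qed (use assms in \<open>auto simp: kronecker_def index_mat_def\<close>)

lemma finsum_kronecker_index_mat:
  assumes "finite A" "\<And>g. g \<in> A \<Longrightarrow> \<rho> g \<in> carrier_mat d d" "N = d * length xs"
  shows "(\<Oplus>\<^bsub>module_mat TYPE(complex) N N\<^esub> g \<in> A. \<rho> g \<otimes>\<^sub>K index_mat xs (F g)) =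
    index_mat (List.product [0..<d] xs) (\<lambda>(a, x) (b, y). \<Sum>g\<in>A. \<rho> g $$ (a, b) * F g x y)"
proof -
  let ?zs = "List.product [0..<d] xs"
  let ?K = "\<lambda>g (a, x) (b, y). \<rho> g $$ (a, b) * F g x y"
  have K: "\<rho> g \<otimes>\<^sub>K index_mat xs (F g) = index_mat ?zs (?K g)" if "g \<in> A" for g
    using assms that by (intro kronecker_index_mat) auto
  have len: "length ?zs = N" using assms by simp
  have "(\<Oplus>\<^bsub>module_mat TYPE(complex) N N\<^esub> g \<in> A. \<rho> g \<otimes>\<^sub>K index_mat xs (F g)) =
      mat N N (\<lambda>ij. \<Sum>g\<in>A. (\<rho> g \<otimes>\<^sub>K index_mat xs (F g)) $$ ij)"
    using assms(1) K len by (intro finsum_mat) (auto simp: index_mat_def)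
  also have "\<dots> = index_mat ?zs (\<lambda>(a, x) (b, y). \<Sum>g\<in>A. \<rho> g $$ (a, b) * F g x y)"
  proof (rule eq_matI)
    fix i j assume "i < dim_row (index_mat ?zs (\<lambda>(a, x) (b, y). \<Sum>g\<in>A. \<rho> g $$ (a, b) * F g x y))"
      "j < dim_col (index_mat ?zs (\<lambda>(a, x) (b, y). \<Sum>g\<in>A. \<rho> g $$ (a, b) * F g x y))"
    then have ij: "i < N" "j < N" by (simp_all add: index_mat_def len del: length_product)
    then have "(\<Sum>g\<in>A. (\<rho> g \<otimes>\<^sub>K index_mat xs (F g)) $$ (i, j)) = (\<Sum>g\<in>A. ?K g (?zs ! i) (?zs ! j))"
      by (intro sum.cong refl) (simp add: K, simp add: index_mat_def len del: length_product)
    then show "mat N N (\<lambda>ij. \<Sum>g\<in>A. (\<rho> g \<otimes>\<^sub>K index_mat xs (F g)) $$ ij) $$ (i, j) =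
        index_mat ?zs (\<lambda>(a, x) (b, y). \<Sum>g\<in>A. \<rho> g $$ (a, b) * F g x y) $$ (i, j)"
      using ij len by (simp add: index_mat_def case_prod_unfold del: length_product)
  qed (simp_all add: index_mat_def len del: length_product)
  finally show ?thesis .
qed

lemma enumerates_product: "enumerates xs S \<Longrightarrow> enumerates (List.product [0..<d] xs) ({..<d} \<times> S)"
  by (auto simp: enumerates_def distinct_product)

lemma index_mat_diff: "index_mat xs F - index_mat xs K = index_mat xs (\<lambda>x y. F x y - K x y)"
  by (rule eq_matI) (auto simp: index_mat_def)

lemma one_mat_eq_index_mat: "enumerates xs S \<Longrightarrow> card S = N \<Longrightarrow> 1\<^sub>m N = index_mat xs kdelta"
  using distinct_card[of xs] by (auto simp: enumerates_def index_mat_kdelta)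

lemma smult_index_mat: "c \<cdot>\<^sub>m index_mat xs F = index_mat xs (\<lambda>x y. c * F x y)"
  by (rule eq_matI) (auto simp: index_mat_def)

lemma det_one_minus_twisted:
  assumes xs: "enumerates xs S" and A: "finite A" and \<rho>: "\<And>g. g \<in> A \<Longrightarrow> \<rho> g \<in> carrier_mat d d"
    and N: "N = d * card S"
  shows "det (1\<^sub>m N - (\<Oplus>\<^bsub>module_mat TYPE(complex) N N\<^esub> g \<in> A. \<rho> g \<otimes>\<^sub>K index_mat xs (F g))) =
    idet ({..<d} \<times> S) (\<lambda>(a, x) (b, y). kdelta (a, x) (b, y) - (\<Sum>g\<in>A. \<rho> g $$ (a, b) * F g x y))"
proof -
  let ?zs = "List.product [0..<d] xs"
  have zs: "enumerates ?zs ({..<d} \<times> S)" by (rule enumerates_product[OF xs])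
  have len: "N = d * length xs" using xs N by (auto simp: enumerates_def distinct_card)
  have one: "1\<^sub>m N = index_mat ?zs kdelta"
    using zs by (rule one_mat_eq_index_mat) (simp add: card_cartesian_product N)
  have sum: "(\<Oplus>\<^bsub>module_mat TYPE(complex) N N\<^esub> g \<in> A. \<rho> g \<otimes>\<^sub>K index_mat xs (F g)) =
      index_mat ?zs (\<lambda>(a, x) (b, y). \<Sum>g\<in>A. \<rho> g $$ (a, b) * F g x y)"
    by (rule finsum_kronecker_index_mat[OF A _ len]) (rule \<rho>)
  show ?thesis
    unfolding sum one index_mat_diff det_index_mat[OF zs]
    by (simp add: case_prod_unfold)
qed

lemma det_smult_one_minus_twisted_minus_diagonal:
  assumes xs: "enumerates xs S" and A: "finite A" and \<rho>: "\<And>g. g \<in> A \<Longrightarrow> \<rho> g \<in> carrier_mat d d"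
    and N: "N = d * card S" and n: "card S = n"
  shows "det (c \<cdot>\<^sub>m 1\<^sub>m N - (\<Oplus>\<^bsub>module_mat TYPE(complex) N N\<^esub> g \<in> A. \<rho> g \<otimes>\<^sub>K index_mat xs (F g))
      - 1\<^sub>m d \<otimes>\<^sub>K mat_diag n (\<lambda>j. H (xs ! j))) =
    idet ({..<d} \<times> S) (\<lambda>(a, x) (b, y). c * kdelta (a, x) (b, y) - (\<Sum>g\<in>A. \<rho> g $$ (a, b) * F g x y)
      - kdelta (a, x) (b, y) * H x)"
proof -
  let ?zs = "List.product [0..<d] xs"
  have zs: "enumerates ?zs ({..<d} \<times> S)" by (rule enumerates_product[OF xs])
  have len: "N = d * length xs" and n': "n = length xs"
    using xs N n by (auto simp: enumerates_def distinct_card)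
  have one: "1\<^sub>m N = index_mat ?zs kdelta"
    using zs by (rule one_mat_eq_index_mat) (simp add: card_cartesian_product N)
  have sum: "(\<Oplus>\<^bsub>module_mat TYPE(complex) N N\<^esub> g \<in> A. \<rho> g \<otimes>\<^sub>K index_mat xs (F g)) =
      index_mat ?zs (\<lambda>(a, x) (b, y). \<Sum>g\<in>A. \<rho> g $$ (a, b) * F g x y)"
    by (rule finsum_kronecker_index_mat[OF A _ len]) (rule \<rho>)
  have diag: "mat_diag n (\<lambda>j. H (xs ! j)) = index_mat xs (\<lambda>x y. kdelta x y * H x)"
    using xs by (intro eq_matI)
      (auto simp: mat_diag_def index_mat_def n' kdelta_def enumerates_def nth_eq_iff_index_eq)
  have "det (c \<cdot>\<^sub>m 1\<^sub>m N - (\<Oplus>\<^bsub>module_mat TYPE(complex) N N\<^esub> g \<in> A. \<rho> g \<otimes>\<^sub>K index_mat xs (F g))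
      - 1\<^sub>m d \<otimes>\<^sub>K mat_diag n (\<lambda>j. H (xs ! j))) = idet ({..<d} \<times> S) (\<lambda>p q. c * kdelta p q
      - (case p of (a, x) \<Rightarrow> \<lambda>(b, y). \<Sum>g\<in>A. \<rho> g $$ (a, b) * F g x y) q
      - (case p of (a, x) \<Rightarrow> \<lambda>(b, y). 1\<^sub>m d $$ (a, b) * (kdelta x y * H x)) q)"
    unfolding sum one smult_index_mat index_mat_diff diag
      kronecker_index_mat[OF one_carrier_mat] det_index_mat[OF zs] ..
  also have "\<dots> = idet ({..<d} \<times> S) (\<lambda>(a, x) (b, y). c * kdelta (a, x) (b, y) - (\<Sum>g\<in>A. \<rho> g $$ (a, b) * F g x y)
      - kdelta (a, x) (b, y) * H x)"
  proof -
    have "1\<^sub>m d $$ (a, b) = kdelta a b" if "a < d" "b < d" for a b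
      using that by (simp add: kdelta_def)
    then show ?thesis using xs by (intro idet_cong) (auto simp: enumerates_def kdelta_Pair mult.assoc)
  qed
  finally show ?thesis .
qed

lemma idet_lessThan_one_Times:
  fixes F :: "nat \<Rightarrow> nat \<Rightarrow> 'i \<Rightarrow> 'i \<Rightarrow> complex"
  assumes "finite S"
  shows "idet ({..<1} \<times> S) (\<lambda>(a, x) (b, y). F a b x y) = idet S (F 0 0)"
proof -
  have "bij_betw (Pair 0) S ({..<1::nat} \<times> S)"
    by (auto simp: bij_betw_def inj_on_def image_iff)
  from idet_reindex[OF assms this, of "\<lambda>(a, x) (b, y). F a b x y"] show ?thesis by simp
qed

section \<open>Coverings of weighted graphs\<close>

text \<open>A covering arc is given by the fibre coordinate of its origin and its base arc. With the
  group element in front, the index set has the shape on which the regular representation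
  acts.\<close>

definition lift_arc :: "('g, 'b) monoid_scheme \<Rightarrow> ('a \<times> 'a \<Rightarrow> 'g) \<Rightarrow> 'g \<times> 'a \<times> 'a \<Rightarrow> ('a \<times> 'g) \<times> 'a \<times> 'g" where
  "lift_arc \<Gamma> \<alpha> = (\<lambda>(g, e). ((fst e, g), (snd e, g \<otimes>\<^bsub>\<Gamma>\<^esub> \<alpha> e)))"

locale weighted_graph =
  fixes G :: "'a pair_pre_digraph" and H :: "'a \<Rightarrow> real" and h \<gamma> :: "'a \<times> 'a \<Rightarrow> real" and \<mu> :: complex
  assumes graph: "pair_graph G" and arc_data: "arc_data G h \<gamma>"
    and denom_nonzero: "\<And>u. u \<in> pverts G \<Longrightarrow> resolvent_denom G H h \<mu> u \<noteq> 0"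
begin

lemma arcs_finite: "finite (parcs G)" and verts_finite: "finite (pverts G)"
  using graph by (simp_all add: pair_graph_def pair_digraph_def pair_fin_digraph_def pair_fin_digraph_axioms_def)

lemma arc_swap: "e \<in> parcs G \<Longrightarrow> prod.swap e \<in> parcs G"
proof -
  interpret pair_graph G by (rule graph)
  show "e \<in> parcs G \<Longrightarrow> prod.swap e \<in> parcs G"
    using pair_sym_arcs by (cases e) (auto simp: symmetric_def sym_def)
qed

lemma arc_ends: "e \<in> parcs G \<Longrightarrow> fst e \<in> pverts G" "e \<in> parcs G \<Longrightarrow> snd e \<in> pverts G"
  and arc_no_loop: "e \<in> parcs G \<Longrightarrow> fst e \<noteq> snd e"
proof -
  interpret pair_graph G by (rule graph)
  show "e \<in> parcs G \<Longrightarrow> fst e \<in> pverts G" "e \<in> parcs G \<Longrightarrow> snd e \<in> pverts G"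
    "e \<in> parcs G \<Longrightarrow> fst e \<noteq> snd e"
    by (simp_all add: arc_fst_in_verts arc_snd_in_verts pair_no_loops)
qed

text \<open>Separates the weight of a transition into one factor for each of the two arcs, so that
  scattering at a vertex is a reversal plus a matrix of rank at most one.\<close>

definition amplitude :: "'a \<times> 'a \<Rightarrow> complex" where
  "amplitude e = of_real (sqrt (h e)) * exp (\<i> * of_real (\<gamma> e))"

lemma scattering_eq:
  "scattering G H h \<gamma> \<mu> u e f =
    \<i> * kdelta (prod.swap e) f - 2 * (amplitude e * amplitude f / resolvent_denom G H h \<mu> u)"
  by (simp add: scattering_def kdelta_def amplitude_def exp_add distrib_left)

lemma amplitude_mult_swap: "e \<in> parcs G \<Longrightarrow> amplitude e * amplitude (prod.swap e) = of_real (h e)"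
proof -
  assume e: "e \<in> parcs G"
  have "amplitude e * amplitude (prod.swap e) =
      of_real (sqrt (h e)) * of_real (sqrt (h e)) * (exp (\<i> * of_real (\<gamma> e)) * exp (- (\<i> * of_real (\<gamma> e))))"
    using arc_data e unfolding amplitude_def arc_data_def by simp
  also have "of_real (sqrt (h e)) * of_real (sqrt (h e)) = complex_of_real (h e)"
    using arc_data e by (simp add: arc_data_def flip: of_real_mult)
  finally show ?thesis by (simp add: exp_minus_inverse)
qed

lemma amplitude_square: "e \<in> parcs G \<Longrightarrow> (amplitude e)\<^sup>2 = of_real (h e) * exp (2 * \<i> * of_real (\<gamma> e))"
  using arc_data
  by (simp add: amplitude_def arc_data_def power_mult_distrib exp_double mult.assoc flip: of_real_power)

lemma sum_amplitude_mult_swap: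
  "(\<Sum>f\<in>{f \<in> parcs G. fst f = u}. amplitude f * amplitude (prod.swap f)) = of_real (out_weight G h u)"
  by (simp add: out_weight_def amplitude_mult_swap)

lemma det_twisted_bond_scattering:
  assumes \<Gamma>: "group \<Gamma>" "finite (carrier \<Gamma>)" and \<alpha>: "voltage_assignment G \<Gamma> \<alpha>"
    and rep: "group_representation \<Gamma> d \<rho>"
    and n: "card (pverts G) = n" and m: "card (parcs G) = 2 * m"
    and vs: "enumerates vs (pverts G)" and es: "enumerates es (parcs G)"
  shows "det (1\<^sub>m (2 * m * d) - (\<Oplus>\<^bsub>module_mat TYPE(complex) (2 * m * d) (2 * m * d)\<^esub> g \<in> carrier \<Gamma>.
            \<rho> g \<otimes>\<^sub>K bond_scattering_part_mat G H h \<gamma> \<mu> \<alpha> g es)) =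
    2 ^ (m * d) * (-1) ^ (n * d) / (\<Prod>u\<in>pverts G. resolvent_denom G H h \<mu> u) ^ d *
    det (\<mu> \<cdot>\<^sub>m 1\<^sub>m (n * d) - (\<Oplus>\<^bsub>module_mat TYPE(complex) (n * d) (n * d)\<^esub> g \<in> carrier \<Gamma>.
            \<rho> g \<otimes>\<^sub>K hermitian_part_mat G h \<gamma> \<alpha> g vs)
         - 1\<^sub>m d \<otimes>\<^sub>K mat_diag n (\<lambda>j. of_real (H (vs ! j))))"
proof -
  interpret group \<Gamma> by (rule \<Gamma>(1))
  let ?E = "parcs G" and ?V = "pverts G" and ?D = "resolvent_denom G H h \<mu>"
  define r where "r e a b = \<rho> (\<alpha> e) $$ (a, b)" for e a b
  have \<alpha>c: "\<alpha> e \<in> carrier \<Gamma>" "\<alpha> (prod.swap e) = inv\<^bsub>\<Gamma>\<^esub> (\<alpha> e)" if "e \<in> ?E" for e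
    using \<alpha> that by (auto simp: voltage_assignment_def)
  have \<rho>c: "\<rho> g \<in> carrier_mat d d" if "g \<in> carrier \<Gamma>" for g
    using representation_carrier[OF rep that] .
  interpret twisted_arcs ?E d r
    by unfold_locales
      (use arcs_finite arc_swap arc_no_loop \<alpha>c representation_inv_index(1)[OF rep] in \<open>auto simp: r_def\<close>)
  have "det (1\<^sub>m (2 * m * d) - (\<Oplus>\<^bsub>module_mat TYPE(complex) (2 * m * d) (2 * m * d)\<^esub> g \<in> carrier \<Gamma>.
            \<rho> g \<otimes>\<^sub>K bond_scattering_part_mat G H h \<gamma> \<mu> \<alpha> g es)) =
      idet ({..<d} \<times> ?E) (\<lambda>(a, e) (b, f). kdelta (a, e) (b, f) - (\<Sum>g\<in>carrier \<Gamma>. \<rho> g $$ (a, b) *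
        (if snd e = fst f \<and> \<alpha> e = g then scattering G H h \<gamma> \<mu> (snd e) e f else 0)))"
    unfolding bond_scattering_part_mat_def
    by (rule det_one_minus_twisted[OF es \<Gamma>(2) \<rho>c]) (use m in auto)
  also have "\<dots> = idet ({..<d} \<times> ?E) (\<lambda>(a, e) (b, f). kdelta (a, e) (b, f) - r e a b *
        (if snd e = fst f then \<i> * kdelta (prod.swap e) f - 2 * (amplitude e * amplitude f / ?D (snd e)) else 0))"
  proof (rule idet_cong)
    fix x y assume "x \<in> {..<d} \<times> ?E" "y \<in> {..<d} \<times> ?E"
    then obtain a e b f where x: "x = (a, e)" "y = (b, f)" "e \<in> ?E" by auto
    have "(\<Sum>g\<in>carrier \<Gamma>. \<rho> g $$ (a, b) * (if snd e = fst f \<and> \<alpha> e = g then scattering G H h \<gamma> \<mu> (snd e) e f else 0)) =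
      (\<Sum>g\<in>carrier \<Gamma>. (\<rho> g $$ (a, b) * (if snd e = fst f then scattering G H h \<gamma> \<mu> (snd e) e f else 0)) * kdelta (\<alpha> e) g)"
      by (intro sum.cong) (auto simp: kdelta_def)
    also have "\<dots> = r e a b * (if snd e = fst f then scattering G H h \<gamma> \<mu> (snd e) e f else 0)"
      using \<Gamma>(2) \<alpha>c x by (simp add: r_def)
    finally show "(case x of (a, e) \<Rightarrow> \<lambda>(b, f). kdelta (a, e) (b, f) - (\<Sum>g\<in>carrier \<Gamma>. \<rho> g $$ (a, b) *
        (if snd e = fst f \<and> \<alpha> e = g then scattering G H h \<gamma> \<mu> (snd e) e f else 0))) y =
      (case x of (a, e) \<Rightarrow> \<lambda>(b, f). kdelta (a, e) (b, f) - r e a b *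
        (if snd e = fst f then \<i> * kdelta (prod.swap e) f - 2 * (amplitude e * amplitude f / ?D (snd e)) else 0)) y"
      by (simp only: x prod.case scattering_eq)
  qed (use arcs_finite in auto)
  also have "\<dots> = 2 ^ (m * d) / (\<Prod>v\<in>?V. ?D v) ^ d *
         idet ({..<d} \<times> ?V) (\<lambda>(b, u) (c, v).
            kdelta (b, u) (c, v) * (?D u + \<i> * (\<Sum>f\<in>{f \<in> ?E. fst f = u}. amplitude f * amplitude (prod.swap f)))
            + (if (u, v) \<in> ?E then (amplitude (u, v))\<^sup>2 * r (u, v) b c else 0))"
    by (rule idet_bond_scattering[OF verts_finite _ denom_nonzero m]) (use arc_ends in auto)
  \<comment> \<open>The sum of amplitude products is the out-weight and cancels against the
    denominator, leaving \<open>H u - \<mu>\<close> on the diagonal. The sign pulled out here yields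
    \<open>(-1) ^ (n * d)\<close>.\<close>
  also have "idet ({..<d} \<times> ?V) (\<lambda>(b, u) (c, v).
            kdelta (b, u) (c, v) * (?D u + \<i> * (\<Sum>f\<in>{f \<in> ?E. fst f = u}. amplitude f * amplitude (prod.swap f)))
            + (if (u, v) \<in> ?E then (amplitude (u, v))\<^sup>2 * r (u, v) b c else 0)) =
      idet ({..<d} \<times> ?V) (\<lambda>p q. - (case p of (b, u) \<Rightarrow> \<lambda>(c, v). \<mu> * kdelta (b, u) (c, v)
          - (\<Sum>g\<in>carrier \<Gamma>. \<rho> g $$ (b, c) * (if (u, v) \<in> ?E \<and> \<alpha> (u, v) = g
               then of_real (h (u, v)) * exp (2 * \<i> * of_real (\<gamma> (u, v))) else 0))
          - kdelta (b, u) (c, v) * of_real (H u)) q)"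
  proof (rule idet_cong)
    fix x y assume "x \<in> {..<d} \<times> ?V" "y \<in> {..<d} \<times> ?V"
    obtain b u c v where x: "x = (b, u)" "y = (c, v)" by fastforce
    have "(\<Sum>g\<in>carrier \<Gamma>. \<rho> g $$ (b, c) * (if (u, v) \<in> ?E \<and> \<alpha> (u, v) = g
               then of_real (h (u, v)) * exp (2 * \<i> * of_real (\<gamma> (u, v))) else 0)) =
      (if (u, v) \<in> ?E then (amplitude (u, v))\<^sup>2 * r (u, v) b c else 0)"
    proof (cases "(u, v) \<in> ?E")
      case True
      have "(\<Sum>g\<in>carrier \<Gamma>. \<rho> g $$ (b, c) * (if (u, v) \<in> ?E \<and> \<alpha> (u, v) = g
               then of_real (h (u, v)) * exp (2 * \<i> * of_real (\<gamma> (u, v))) else 0)) =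
        (\<Sum>g\<in>carrier \<Gamma>. (\<rho> g $$ (b, c) * (amplitude (u, v))\<^sup>2) * kdelta (\<alpha> (u, v)) g)"
        unfolding amplitude_square[OF True] using True by (intro sum.cong) (auto simp: kdelta_def)
      also have "\<dots> = (amplitude (u, v))\<^sup>2 * r (u, v) b c"
        using \<Gamma>(2) \<alpha>c[OF True] by (simp add: r_def)
      finally show ?thesis using True by simp
    qed simp
    then show "(case x of (b, u) \<Rightarrow> \<lambda>(c, v).
            kdelta (b, u) (c, v) * (?D u + \<i> * (\<Sum>f\<in>{f \<in> ?E. fst f = u}. amplitude f * amplitude (prod.swap f)))
            + (if (u, v) \<in> ?E then (amplitude (u, v))\<^sup>2 * r (u, v) b c else 0)) y =
       - (case x of (b, u) \<Rightarrow> \<lambda>(c, v). \<mu> * kdelta (b, u) (c, v)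
          - (\<Sum>g\<in>carrier \<Gamma>. \<rho> g $$ (b, c) * (if (u, v) \<in> ?E \<and> \<alpha> (u, v) = g
               then of_real (h (u, v)) * exp (2 * \<i> * of_real (\<gamma> (u, v))) else 0))
          - kdelta (b, u) (c, v) * of_real (H u)) y"
      unfolding x prod.case sum_amplitude_mult_swap resolvent_denom_def by (simp add: algebra_simps)
  qed (use verts_finite in auto)
  also have "\<dots> = (-1) ^ (n * d) * det (\<mu> \<cdot>\<^sub>m 1\<^sub>m (n * d) - (\<Oplus>\<^bsub>module_mat TYPE(complex) (n * d) (n * d)\<^esub> g \<in> carrier \<Gamma>.
            \<rho> g \<otimes>\<^sub>K hermitian_part_mat G h \<gamma> \<alpha> g vs)
         - 1\<^sub>m d \<otimes>\<^sub>K mat_diag n (\<lambda>j. of_real (H (vs ! j))))"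
    unfolding hermitian_part_mat_def
    using verts_finite n
    by (subst det_smult_one_minus_twisted_minus_diagonal[OF vs \<Gamma>(2) \<rho>c])
      (auto simp: idet_uminus card_cartesian_product mult.commute)
  finally show ?thesis by simp
qed

text \<open>Every arc has exactly one voltage, so the parts belonging to the group elements add up
  to the full matrix.\<close>

lemma det_trivial_bond_scattering:
  assumes \<Gamma>: "finite (carrier \<Gamma>)" and \<alpha>: "voltage_assignment G \<Gamma> \<alpha>"
    and triv: "\<forall>g\<in>carrier \<Gamma>. \<rho> g = 1\<^sub>m 1" and m: "card (parcs G) = 2 * m"
    and es: "enumerates es (parcs G)"
  shows "det (1\<^sub>m (2 * m) - (\<Oplus>\<^bsub>module_mat TYPE(complex) (2 * m) (2 * m)\<^esub> g \<in> carrier \<Gamma>.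
            \<rho> g \<otimes>\<^sub>K bond_scattering_part_mat G H h \<gamma> \<mu> \<alpha> g es)) =
    det (1\<^sub>m (2 * m) - bond_scattering_mat G H h \<gamma> \<mu> es)"
proof -
  let ?F = "\<lambda>g e f. if snd e = fst f \<and> \<alpha> e = g then scattering G H h \<gamma> \<mu> (snd e) e f else 0"
  have \<alpha>c: "\<alpha> e \<in> carrier \<Gamma>" if "e \<in> parcs G" for e
    using \<alpha> that by (auto simp: voltage_assignment_def)
  have "det (1\<^sub>m (2 * m) - (\<Oplus>\<^bsub>module_mat TYPE(complex) (2 * m) (2 * m)\<^esub> g \<in> carrier \<Gamma>.
            \<rho> g \<otimes>\<^sub>K bond_scattering_part_mat G H h \<gamma> \<mu> \<alpha> g es)) =
      idet ({..<1} \<times> parcs G) (\<lambda>(a, e) (b, f). kdelta (a, e) (b, f) - (\<Sum>g\<in>carrier \<Gamma>. \<rho> g $$ (a, b) * ?F g e f))"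
    unfolding bond_scattering_part_mat_def
    by (rule det_one_minus_twisted[OF es \<Gamma>]) (use m triv in auto)
  also have "\<dots> = idet (parcs G) (\<lambda>e f. kdelta (0::nat, e) (0, f) - (\<Sum>g\<in>carrier \<Gamma>. \<rho> g $$ (0, 0) * ?F g e f))"
    by (rule idet_lessThan_one_Times[OF arcs_finite])
  also have "\<dots> = idet (parcs G) (\<lambda>e f. kdelta e f - (if snd e = fst f then scattering G H h \<gamma> \<mu> (snd e) e f else 0))"
  proof (rule idet_cong[OF arcs_finite])
    fix e f assume e: "e \<in> parcs G"
    have "(\<Sum>g\<in>carrier \<Gamma>. \<rho> g $$ (0, 0) * ?F g e f) =
      (\<Sum>g\<in>carrier \<Gamma>. (if snd e = fst f then scattering G H h \<gamma> \<mu> (snd e) e f else 0) * kdelta (\<alpha> e) g)"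
      using triv by (intro sum.cong) (auto simp: kdelta_def)
    also have "\<dots> = (if snd e = fst f then scattering G H h \<gamma> \<mu> (snd e) e f else 0)"
      using \<Gamma> \<alpha>c[OF e] by simp
    finally show "kdelta (0::nat, e) (0, f) - (\<Sum>g\<in>carrier \<Gamma>. \<rho> g $$ (0, 0) * ?F g e f) =
      kdelta e f - (if snd e = fst f then scattering G H h \<gamma> \<mu> (snd e) e f else 0)"
      by (simp add: kdelta_Pair)
  qed
  also have "\<dots> = det (1\<^sub>m (2 * m) - bond_scattering_mat G H h \<gamma> \<mu> es)"
  proof -
    have "1\<^sub>m (2 * m) = index_mat es kdelta"
      using es m by (rule one_mat_eq_index_mat)
    then show ?thesis unfolding bond_scattering_mat_def by (simp add: index_mat_diff det_index_mat[OF es])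
  qed
  finally show ?thesis .
qed

text \<open>The parts carry no diagonal, since there are no loops; adding the separate diagonal term
  completes the Hermitian matrix.\<close>

lemma det_trivial_hermitian:
  assumes \<Gamma>: "finite (carrier \<Gamma>)" and \<alpha>: "voltage_assignment G \<Gamma> \<alpha>"
    and triv: "\<forall>g\<in>carrier \<Gamma>. \<rho> g = 1\<^sub>m 1" and n: "card (pverts G) = n"
    and vs: "enumerates vs (pverts G)"
  shows "det (\<mu> \<cdot>\<^sub>m 1\<^sub>m n - (\<Oplus>\<^bsub>module_mat TYPE(complex) n n\<^esub> g \<in> carrier \<Gamma>.
            \<rho> g \<otimes>\<^sub>K hermitian_part_mat G h \<gamma> \<alpha> g vs)
         - 1\<^sub>m 1 \<otimes>\<^sub>K mat_diag n (\<lambda>j. of_real (H (vs ! j)))) =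
    det (\<mu> \<cdot>\<^sub>m 1\<^sub>m n - hermitian_mat G H h \<gamma> vs)"
proof -
  let ?c = "\<lambda>u v. of_real (h (u, v)) * exp (2 * \<i> * of_real (\<gamma> (u, v)))"
  let ?F = "\<lambda>g u v. if (u, v) \<in> parcs G \<and> \<alpha> (u, v) = g then ?c u v else 0"
  have \<alpha>c: "\<alpha> e \<in> carrier \<Gamma>" if "e \<in> parcs G" for e
    using \<alpha> that by (auto simp: voltage_assignment_def)
  have "det (\<mu> \<cdot>\<^sub>m 1\<^sub>m n - (\<Oplus>\<^bsub>module_mat TYPE(complex) n n\<^esub> g \<in> carrier \<Gamma>.
            \<rho> g \<otimes>\<^sub>K hermitian_part_mat G h \<gamma> \<alpha> g vs)
         - 1\<^sub>m 1 \<otimes>\<^sub>K mat_diag n (\<lambda>j. of_real (H (vs ! j)))) =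
      idet ({..<1} \<times> pverts G) (\<lambda>(a, u) (b, v). \<mu> * kdelta (a, u) (b, v) - (\<Sum>g\<in>carrier \<Gamma>. \<rho> g $$ (a, b) * ?F g u v)
        - kdelta (a, u) (b, v) * of_real (H u))"
    unfolding hermitian_part_mat_def
    by (rule det_smult_one_minus_twisted_minus_diagonal[OF vs \<Gamma>]) (use n triv in auto)
  also have "\<dots> = idet (pverts G) (\<lambda>u v. \<mu> * kdelta (0::nat, u) (0, v) - (\<Sum>g\<in>carrier \<Gamma>. \<rho> g $$ (0, 0) * ?F g u v)
        - kdelta (0::nat, u) (0, v) * of_real (H u))"
    by (rule idet_lessThan_one_Times[OF verts_finite])
  also have "\<dots> = idet (pverts G) (\<lambda>u v. \<mu> * kdelta u v -
      (if u = v then of_real (H u) else if (u, v) \<in> parcs G then ?c u v else 0))"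
  proof (rule idet_cong[OF verts_finite])
    fix u v
    have "(\<Sum>g\<in>carrier \<Gamma>. \<rho> g $$ (0, 0) * ?F g u v) =
      (\<Sum>g\<in>carrier \<Gamma>. (if (u, v) \<in> parcs G then ?c u v else 0) * kdelta (\<alpha> (u, v)) g)"
      using triv by (intro sum.cong) (auto simp: kdelta_def)
    also have "\<dots> = (if (u, v) \<in> parcs G then ?c u v else 0)"
      using \<Gamma> \<alpha>c[of "(u, v)"] by auto
    finally show "\<mu> * kdelta (0::nat, u) (0, v) - (\<Sum>g\<in>carrier \<Gamma>. \<rho> g $$ (0, 0) * ?F g u v)
        - kdelta (0::nat, u) (0, v) * of_real (H u) = \<mu> * kdelta u v -
      (if u = v then of_real (H u) else if (u, v) \<in> parcs G then ?c u v else 0)"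
      using arc_no_loop[of "(u, v)"] by (auto simp: kdelta_def)
  qed
  also have "\<dots> = det (\<mu> \<cdot>\<^sub>m 1\<^sub>m n - hermitian_mat G H h \<gamma> vs)"
  proof -
    have "1\<^sub>m n = index_mat vs kdelta"
      using vs n by (rule one_mat_eq_index_mat)
    then show ?thesis
      unfolding hermitian_mat_def by (simp add: smult_index_mat index_mat_diff det_index_mat[OF vs])
  qed
  finally show ?thesis .
qed

lemma bij_betw_lift_arc:
  "bij_betw (lift_arc \<Gamma> \<alpha>) (carrier \<Gamma> \<times> parcs G) (parcs (derived_graph G \<Gamma> \<alpha>))"
  unfolding bij_betw_def
proof
  show "inj_on (lift_arc \<Gamma> \<alpha>) (carrier \<Gamma> \<times> parcs G)"
    by (auto simp: inj_on_def lift_arc_def)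
  show "lift_arc \<Gamma> \<alpha> ` (carrier \<Gamma> \<times> parcs G) = parcs (derived_graph G \<Gamma> \<alpha>)"
    by (force simp: lift_arc_def derived_graph_def)
qed

text \<open>The covering projection maps the arcs leaving \<open>(u, g)\<close> bijectively, with
  their weights, to those leaving \<open>u\<close>.\<close>

lemma resolvent_denom_derived:
  assumes "g \<in> carrier \<Gamma>"
  shows "resolvent_denom (derived_graph G \<Gamma> \<alpha>) (lift_vertex_data H) (lift_arc_data h) \<mu> (u, g) =
    resolvent_denom G H h \<mu> u"
proof -
  have "bij_betw (\<lambda>e. lift_arc \<Gamma> \<alpha> (g, e)) {e \<in> parcs G. fst e = u}
      {f \<in> parcs (derived_graph G \<Gamma> \<alpha>). fst f = (u, g)}"
    unfolding bij_betw_def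
  proof
    show "inj_on (\<lambda>e. lift_arc \<Gamma> \<alpha> (g, e)) {e \<in> parcs G. fst e = u}"
      by (auto simp: inj_on_def lift_arc_def)
    show "(\<lambda>e. lift_arc \<Gamma> \<alpha> (g, e)) ` {e \<in> parcs G. fst e = u} =
        {f \<in> parcs (derived_graph G \<Gamma> \<alpha>). fst f = (u, g)}"
      using assms by (force simp: lift_arc_def derived_graph_def)
  qed
  from sum.reindex_bij_betw[OF this, of "lift_arc_data h"]
  have "out_weight (derived_graph G \<Gamma> \<alpha>) (lift_arc_data h) (u, g) = out_weight G h u"
    unfolding out_weight_def
    by (simp only: lift_arc_def lift_arc_data_def prod.case prod.collapse)
  then show ?thesis by (simp add: resolvent_denom_def lift_vertex_data_def)
qed

text \<open>The lift of \<open>e\<close> starting in the sheet \<open>g\<close> ends in the sheet of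
  g times the voltage of \<open>e\<close>. Sheets are thus permuted by right multiplication, which
  brings in the regular representation.\<close>

lemma det_derived_bond_scattering:
  assumes \<Gamma>: "group \<Gamma>" "finite (carrier \<Gamma>)" and \<alpha>: "voltage_assignment G \<Gamma> \<alpha>"
    and m: "card (parcs G) = 2 * m" and p: "Coset.order \<Gamma> = p"
    and es': "enumerates es' (parcs (derived_graph G \<Gamma> \<alpha>))"
  shows "det (1\<^sub>m (2 * m * p) - bond_scattering_mat (derived_graph G \<Gamma> \<alpha>)
              (lift_vertex_data H) (lift_arc_data h) (lift_arc_data \<gamma>) \<mu> es') =
    idet (carrier \<Gamma> \<times> parcs G) (\<lambda>(g, e) (g', f). kdelta (g, e) (g', f)
      - (\<Sum>k\<in>carrier \<Gamma>. kdelta (g \<otimes>\<^bsub>\<Gamma>\<^esub> k) g' *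
          (if snd e = fst f \<and> \<alpha> e = k then scattering G H h \<gamma> \<mu> (snd e) e f else 0)))"
proof -
  interpret group \<Gamma> by (rule \<Gamma>(1))
  let ?G = "derived_graph G \<Gamma> \<alpha>" and ?l = "lift_arc \<Gamma> \<alpha>"
  let ?s = "scattering ?G (lift_vertex_data H) (lift_arc_data h) (lift_arc_data \<gamma>) \<mu>"
  have \<alpha>c: "\<alpha> e \<in> carrier \<Gamma>" "\<alpha> (prod.swap e) = inv\<^bsub>\<Gamma>\<^esub> (\<alpha> e)" if "e \<in> parcs G" for e
    using \<alpha> that by (auto simp: voltage_assignment_def)
  have fin: "finite (carrier \<Gamma> \<times> parcs G)" using \<Gamma>(2) arcs_finite by simp
  have "card (parcs ?G) = 2 * m * p"
    using bij_betw_same_card[OF bij_betw_lift_arc[of \<Gamma> \<alpha>]] m p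
    by (simp add: card_cartesian_product Coset.order_def mult.commute)
  with es' have "1\<^sub>m (2 * m * p) = index_mat es' kdelta"
    by (rule one_mat_eq_index_mat)
  then have "det (1\<^sub>m (2 * m * p) - bond_scattering_mat ?G
              (lift_vertex_data H) (lift_arc_data h) (lift_arc_data \<gamma>) \<mu> es') =
      idet (parcs ?G) (\<lambda>e f. kdelta e f - (if snd e = fst f then ?s (snd e) e f else 0))"
    unfolding bond_scattering_mat_def by (simp add: index_mat_diff det_index_mat[OF es'])
  also have "\<dots> = idet (carrier \<Gamma> \<times> parcs G) (\<lambda>x y. kdelta (?l x) (?l y)
      - (if snd (?l x) = fst (?l y) then ?s (snd (?l x)) (?l x) (?l y) else 0))"
    by (rule idet_reindex[OF fin bij_betw_lift_arc, symmetric])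
  also have "\<dots> = idet (carrier \<Gamma> \<times> parcs G) (\<lambda>(g, e) (g', f). kdelta (g, e) (g', f)
      - (\<Sum>k\<in>carrier \<Gamma>. kdelta (g \<otimes>\<^bsub>\<Gamma>\<^esub> k) g' *
          (if snd e = fst f \<and> \<alpha> e = k then scattering G H h \<gamma> \<mu> (snd e) e f else 0)))"
  proof (rule idet_cong[OF fin])
    fix x y assume xy: "x \<in> carrier \<Gamma> \<times> parcs G" "y \<in> carrier \<Gamma> \<times> parcs G"
    then obtain g e g' f where x: "x = (g, e)" "y = (g', f)" "g \<in> carrier \<Gamma>" "e \<in> parcs G"
      "g' \<in> carrier \<Gamma>" "f \<in> parcs G" by auto
    have "inj_on ?l (carrier \<Gamma> \<times> parcs G)" using bij_betw_lift_arc by (rule bij_betw_imp_inj_on)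
    then have 1: "kdelta (?l x) (?l y) = kdelta x y"
      using xy by (auto simp: kdelta_def inj_on_def)
    have 2: "?s (snd (?l x)) (?l x) (?l y) = scattering G H h \<gamma> \<mu> (snd e) e f"
      if eq: "snd (?l x) = fst (?l y)"
    proof -
      have eqs: "snd e = fst f" "g \<otimes>\<^bsub>\<Gamma>\<^esub> \<alpha> e = g'" using eq by (auto simp: x lift_arc_def)
      \<comment> \<open>Backscattering lifts: the voltage of the reversed arc leads back to the
        sheet \<open>g\<close>, so for consecutive lifted arcs reversal may be tested in the
        base.\<close>
      have "prod.swap (?l x) = ?l y \<longleftrightarrow> prod.swap e = f"
      proof
        assume "prod.swap (?l x) = ?l y"
        then show "prod.swap e = f" by (auto simp: x lift_arc_def prod_eq_iff)
      next
        assume f: "prod.swap e = f"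
        have "g' \<otimes>\<^bsub>\<Gamma>\<^esub> \<alpha> f = g"
          using x(3) \<alpha>c[OF x(4)] unfolding eqs(2)[symmetric] f[symmetric] by (simp add: m_assoc)
        then show "prod.swap (?l x) = ?l y"
          using eqs by (simp add: x(1,2) lift_arc_def flip: f)
      qed
      moreover have "snd (?l x) = (snd e, g \<otimes>\<^bsub>\<Gamma>\<^esub> \<alpha> e)" by (simp add: x lift_arc_def)
      moreover have "g \<otimes>\<^bsub>\<Gamma>\<^esub> \<alpha> e \<in> carrier \<Gamma>" using x \<alpha>c by simp
      ultimately show ?thesis
        by (simp add: scattering_def resolvent_denom_derived) (simp add: x lift_arc_def lift_arc_data_def)
    qed
    have "(\<Sum>k\<in>carrier \<Gamma>. kdelta (g \<otimes>\<^bsub>\<Gamma>\<^esub> k) g' *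
          (if snd e = fst f \<and> \<alpha> e = k then scattering G H h \<gamma> \<mu> (snd e) e f else 0)) =
        (\<Sum>k\<in>carrier \<Gamma>. (kdelta (g \<otimes>\<^bsub>\<Gamma>\<^esub> k) g' *
          (if snd e = fst f then scattering G H h \<gamma> \<mu> (snd e) e f else 0)) * kdelta (\<alpha> e) k)"
      by (intro sum.cong) (auto simp: kdelta_def)
    also have "\<dots> = kdelta (g \<otimes>\<^bsub>\<Gamma>\<^esub> \<alpha> e) g' * (if snd e = fst f then scattering G H h \<gamma> \<mu> (snd e) e f else 0)"
      using \<Gamma>(2) \<alpha>c[OF x(4)] by simp
    also have "\<dots> = (if snd (?l x) = fst (?l y) then ?s (snd (?l x)) (?l x) (?l y) else 0)"
      using 2 by (auto simp: x lift_arc_def kdelta_def)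
    finally show "kdelta (?l x) (?l y) - (if snd (?l x) = fst (?l y) then ?s (snd (?l x)) (?l x) (?l y) else 0) =
      (case x of (g, e) \<Rightarrow> \<lambda>(g', f). kdelta (g, e) (g', f)
      - (\<Sum>k\<in>carrier \<Gamma>. kdelta (g \<otimes>\<^bsub>\<Gamma>\<^esub> k) g' *
          (if snd e = fst f \<and> \<alpha> e = k then scattering G H h \<gamma> \<mu> (snd e) e f else 0))) y"
      unfolding 1 by (simp add: x)
  qed
  finally show ?thesis .
qed

end

theorem theorem6:
  fixes G :: "'a pair_pre_digraph"
    and H :: "'a \<Rightarrow> real"
    and h \<gamma> :: "'a \<times> 'a \<Rightarrow> real"
    and \<Gamma> :: "('g, 'b) monoid_scheme"
    and \<alpha> :: "'a \<times> 'a \<Rightarrow> 'g"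
    and \<rho> :: "nat \<Rightarrow> 'g \<Rightarrow> complex mat"
    and f :: "nat \<Rightarrow> nat"
    and n m p k :: nat
    and \<mu> :: complex
    and vs :: "'a list"
    and es :: "('a \<times> 'a) list"
    and es' :: "(('a \<times> 'g) \<times> ('a \<times> 'g)) list"
  assumes "pair_graph G" and "Digraph_Component.connected (with_proj G)"
    and "card (pverts G) = n" and "card (parcs G) = 2 * m"
    and "arc_data G h \<gamma>"
    and "group \<Gamma>" and "finite (carrier \<Gamma>)" and "Coset.order \<Gamma> = p"
    and "voltage_assignment G \<Gamma> \<alpha>"
    and "all_irreducible_representations \<Gamma> k f \<rho>"
    and "f 1 = 1" and "\<forall>g \<in> carrier \<Gamma>. \<rho> 1 g = 1\<^sub>m 1"
    and "\<forall>u \<in> pverts G. resolvent_denom G H h \<mu> u \<noteq> 0"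
    and "Digraph_Component.connected (with_proj (derived_graph G \<Gamma> \<alpha>))"
    and "enumerates vs (pverts G)"
    and "enumerates es (parcs G)"
    and "enumerates es' (parcs (derived_graph G \<Gamma> \<alpha>))"
  shows
    "det (1\<^sub>m (2 * m * p)
          - bond_scattering_mat (derived_graph G \<Gamma> \<alpha>)
              (lift_vertex_data H) (lift_arc_data h) (lift_arc_data \<gamma>) \<mu> es')
     = det (1\<^sub>m (2 * m) - bond_scattering_mat G H h \<gamma> \<mu> es)
       * (\<Prod>i = 2..k.
            det (1\<^sub>m (2 * m * f i)
                 - (\<Oplus>\<^bsub>module_mat TYPE(complex) (2 * m * f i) (2 * m * f i)\<^esub> g \<in> carrier \<Gamma>.
                      \<rho> i g \<otimes>\<^sub>K bond_scattering_part_mat G H h \<gamma> \<mu> \<alpha> g es)) ^ f i)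
     \<and>
     det (1\<^sub>m (2 * m) - bond_scattering_mat G H h \<gamma> \<mu> es)
       * (\<Prod>i = 2..k.
            det (1\<^sub>m (2 * m * f i)
                 - (\<Oplus>\<^bsub>module_mat TYPE(complex) (2 * m * f i) (2 * m * f i)\<^esub> g \<in> carrier \<Gamma>.
                      \<rho> i g \<otimes>\<^sub>K bond_scattering_part_mat G H h \<gamma> \<mu> \<alpha> g es)) ^ f i)
     = 2 ^ (m * p) * (-1) ^ (n * p) * det (\<mu> \<cdot>\<^sub>m 1\<^sub>m n - hermitian_mat G H h \<gamma> vs)
         / (\<Prod>u \<in> pverts G. resolvent_denom G H h \<mu> u ^ p)
       * (\<Prod>i = 2..k.
            det (\<mu> \<cdot>\<^sub>m 1\<^sub>m (n * f i)
                 - (\<Oplus>\<^bsub>module_mat TYPE(complex) (n * f i) (n * f i)\<^esub> g \<in> carrier \<Gamma>.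
                      \<rho> i g \<otimes>\<^sub>K hermitian_part_mat G h \<gamma> \<alpha> g vs)
                 - 1\<^sub>m (f i) \<otimes>\<^sub>K mat_diag n (\<lambda>j. of_real (H (vs ! j)))) ^ f i)"
proof -
  interpret weighted_graph G H h \<gamma> \<mu>
    using assms(1,5,13) by (simp add: weighted_graph.intro)
  note irr = assms(10)
  define A where "A i = det (1\<^sub>m (2 * m * f i)
                 - (\<Oplus>\<^bsub>module_mat TYPE(complex) (2 * m * f i) (2 * m * f i)\<^esub> g \<in> carrier \<Gamma>.
                      \<rho> i g \<otimes>\<^sub>K bond_scattering_part_mat G H h \<gamma> \<mu> \<alpha> g es))" for i
  define B where "B i = det (\<mu> \<cdot>\<^sub>m 1\<^sub>m (n * f i)
                 - (\<Oplus>\<^bsub>module_mat TYPE(complex) (n * f i) (n * f i)\<^esub> g \<in> carrier \<Gamma>.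
                      \<rho> i g \<otimes>\<^sub>K hermitian_part_mat G h \<gamma> \<alpha> g vs)
                 - 1\<^sub>m (f i) \<otimes>\<^sub>K mat_diag n (\<lambda>j. of_real (H (vs ! j))))" for i
  let ?D = "\<Prod>u\<in>pverts G. resolvent_denom G H h \<mu> u"
  have rep: "group_representation \<Gamma> (f i) (\<rho> i)" if "i \<in> {1..k}" for i
    using irr that by (auto simp: all_irreducible_representations_def irreducible_representation_def)
  have sq: "(\<Sum>i = 1..k. (f i)\<^sup>2) = p"
    using group.sum_degree_squares[OF assms(6) irr assms(7)] assms(8) by simp
  have "p > 0"
    using assms(6-8) by (metis group.is_monoid monoid.one_closed card_gt_0_iff Coset.order_def empty_iff)
  \<comment> \<open>An empty list of representations would give \<open>p = 0\<close>; hence the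
    index 1 of the trivial one is present and its factor can be split off.\<close>
  then have k: "1 \<le> k" using sq by (cases k) auto
  have split: "(\<Prod>i = 1..k. F i) = F 1 * (\<Prod>i = 2..k. F i)" for F :: "nat \<Rightarrow> complex"
    using k by (simp add: prod.atLeast_Suc_atMost numeral_2_eq_2)
  have A1: "A 1 = det (1\<^sub>m (2 * m) - bond_scattering_mat G H h \<gamma> \<mu> es)"
    using det_trivial_bond_scattering[OF assms(7,9,12,4,16)] assms(11) by (simp add: A_def)
  have B1: "B 1 = det (\<mu> \<cdot>\<^sub>m 1\<^sub>m n - hermitian_mat G H h \<gamma> vs)"
    using det_trivial_hermitian[OF assms(7,9,12,3,15)] assms(11) by (simp add: B_def)
  have A_idet: "A i = idet ({..<f i} \<times> parcs G) (\<lambda>(a, e) (b, e'). kdelta (a, e) (b, e') -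
      (\<Sum>g\<in>carrier \<Gamma>. \<rho> i g $$ (a, b) *
        (if snd e = fst e' \<and> \<alpha> e = g then scattering G H h \<gamma> \<mu> (snd e) e e' else 0)))"
    if "i \<in> {1..k}" for i
    unfolding A_def bond_scattering_part_mat_def
    by (rule det_one_minus_twisted[OF assms(16,7) representation_carrier[OF rep[OF that]]]) (use assms(4) in auto)
  have first: "det (1\<^sub>m (2 * m * p) - bond_scattering_mat (derived_graph G \<Gamma> \<alpha>)
              (lift_vertex_data H) (lift_arc_data h) (lift_arc_data \<gamma>) \<mu> es') = (\<Prod>i = 1..k. A i ^ f i)"
    unfolding det_derived_bond_scattering[OF assms(6,7,9,4,8,17)]
      group.regular_representation_idet[OF assms(6) irr assms(7) arcs_finite]
    by (intro prod.cong refl) (simp only: A_idet)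
  have AB: "A i = 2 ^ (m * f i) * (-1) ^ (n * f i) / ?D ^ f i * B i" if "i \<in> {1..k}" for i
    unfolding A_def B_def by (rule det_twisted_bond_scattering[OF assms(6,7,9) rep[OF that] assms(3,4,15,16)])
  have "(\<Prod>i = 1..k. A i ^ f i) = (\<Prod>i = 1..k. (2 ^ m * (-1) ^ n / ?D) ^ (f i)\<^sup>2 * B i ^ f i)"
  proof (intro prod.cong refl)
    fix i assume "i \<in> {1..k}"
    then show "A i ^ f i = (2 ^ m * (-1) ^ n / ?D) ^ (f i)\<^sup>2 * B i ^ f i"
      by (simp add: AB power_mult_distrib power_divide power2_eq_square flip: power_mult)
        (simp add: mult_ac)
  qed
  \<comment> \<open>The constant of each factor has exponent \<open>(f i)\<^sup>2\<close>; these
    exponents add up to \<open>p\<close>.\<close>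
  also have "\<dots> = (2 ^ m * (-1) ^ n / ?D) ^ p * (\<Prod>i = 1..k. B i ^ f i)"
    by (simp only: prod.distrib power_sum[symmetric] sq)
  also have "\<dots> = 2 ^ (m * p) * (-1) ^ (n * p) * B 1 / (\<Prod>u\<in>pverts G. resolvent_denom G H h \<mu> u ^ p) * (\<Prod>i = 2..k. B i ^ f i)"
    unfolding split using assms(11)
    by (simp add: power_mult_distrib power_divide prod_power_distrib flip: power_mult)
  finally have second: "(\<Prod>i = 1..k. A i ^ f i) =
    2 ^ (m * p) * (-1) ^ (n * p) * B 1 / (\<Prod>u\<in>pverts G. resolvent_denom G H h \<mu> u ^ p) * (\<Prod>i = 2..k. B i ^ f i)" .
  have third: "(\<Prod>i = 1..k. A i ^ f i) = A 1 * (\<Prod>i = 2..k. A i ^ f i)"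
    unfolding split using assms(11) by simp
  show ?thesis
    using first second unfolding third A1 B1 unfolding A_def B_def by blast
qed

end
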